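(* Let $0<\alpha\le 1$, let $n\ge 1$, and let $p(x)=\sum_{a\in\mathcal A}c_a x^a$ be a homogeneous posynomial in $n$ variables of degree $d>0$. Suppose that $p$ is $\Gamma_\alpha$-stable, i.e. the principal branch of $p$ has no zero on $\Gamma_\alpha^n$. Then the function $$x\longmapsto p(x_1^\alpha,\dots,x_n^\alpha)^{1/(\alpha d)}$$ is concave on $\mathbb R_{>0}^n$. Consequently, $x\mapsto \log p(x_1^\alpha,\dots,x_n^\alpha)$ is concave on $\mathbb R_{>0}^n$.
   Context: A posynomial in $n$ variables is a finite sum $p(x)=\sum_{a\in\mathcal A}c_a x^a=\sum_{a\in\mathcal A}c_a\prod_{i=1}^n x_i^{a_i}$, where $\mathcal A\subset\mathbb R_{\ge 0}^n$ is finite and $c_a>0$ for every $a\in\mathcal A$ (exponents are arbitrary nonnegative reals). It is homogeneous of degree $d$ if $\sum_i a_i=d$ for every $a\in\mathcal A$. On $\mathbb C\setminus(-\infty,0]$ real powers are defined using the principal logarithm, $z^{s}=\exp(s\operatorname{Log} z)$ with $\operatorname{Im}\operatorname{Log} z\in(-\pi,\pi)$; this defines a holomorphic function $p$ (the principal branch) on $(\mathbb C\setminus(-\infty,0])^n$. For $0<\alpha\le 1$, $\Gamma_\alpha=\{re^{i\theta}: r>0,\ |\theta|<\alpha\pi/2\}$ is the open sector of aperture $\alpha\pi$ centered on the positive real axis. The posynomial $p$ is $\Gamma_\alpha$-stable if its principal branch has no zero on $\Gamma_\alpha^n$. *)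

theory Defs
  imports "HOL-Analysis.Analysis"
begin

definition pos_orthant :: "(real ^ 'n) set" where
  "pos_orthant = {x. \<forall>i. 0 < x $ i}"

(* A posynomial is represented by its finite set A of exponent vectors together with its
   coefficient function c, of which only the values on A matter. *)
definition posynomial :: "(real ^ 'n) set \<Rightarrow> (real ^ 'n \<Rightarrow> real) \<Rightarrow> bool" where
  "posynomial A c \<longleftrightarrow> finite A \<and> (\<forall>a\<in>A. (\<forall>i. 0 \<le> a $ i) \<and> 0 < c a)"

definition homogeneous_of_degree :: "real \<Rightarrow> (real ^ 'n) set \<Rightarrow> bool" where
  "homogeneous_of_degree d A \<longleftrightarrow> (\<forall>a\<in>A. (\<Sum>i\<in>UNIV. a $ i) = d)"

(* Intended for x in the open positive orthant; powr maps base 0 to 0, even for exponent 0. *)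
definition posy_eval ::
  "(real ^ 'n) set \<Rightarrow> (real ^ 'n \<Rightarrow> real) \<Rightarrow> real ^ 'n \<Rightarrow> real" where
  "posy_eval A c x = (\<Sum>a\<in>A. c a * (\<Prod>i\<in>UNIV. (x $ i) powr (a $ i)))"

(* On complex numbers z powr s = exp (s * Ln z) for z \<noteq> 0, with Im (Ln z) in (-pi, pi],
   so this is the principal branch whenever no coordinate lies in (-\<infinity>, 0]. *)
definition posy_principal ::
  "(real ^ 'n) set \<Rightarrow> (real ^ 'n \<Rightarrow> real) \<Rightarrow> complex ^ 'n \<Rightarrow> complex" where
  "posy_principal A c z =
     (\<Sum>a\<in>A. of_real (c a) * (\<Prod>i\<in>UNIV. (z $ i) powr (of_real (a $ i))))"

definition sector :: "real \<Rightarrow> complex set" where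
  "sector \<alpha> = {of_real r * cis \<theta> | r \<theta>. 0 < r \<and> \<bar>\<theta>\<bar> < \<alpha> * pi / 2}"

definition sector_stable ::
  "real \<Rightarrow> (real ^ 'n) set \<Rightarrow> (real ^ 'n \<Rightarrow> real) \<Rightarrow> bool" where
  "sector_stable \<alpha> A c \<longleftrightarrow>
     (\<forall>z. (\<forall>i. z $ i \<in> sector \<alpha>) \<longrightarrow> posy_principal A c z \<noteq> 0)"

lemma sector_slit_plane:
  assumes "\<alpha> \<le> 1"
  shows "sector \<alpha> \<inter> \<real>\<^sub>\<le>\<^sub>0 = {}"
proof -
  have "z \<notin> \<real>\<^sub>\<le>\<^sub>0" if z: "z \<in> sector \<alpha>" for z
  proof -
    obtain r \<theta> where r: "z = of_real r * cis \<theta>" "0 < r" "\<bar>\<theta>\<bar> < \<alpha> * pi / 2"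
      using z by (auto simp: sector_def)
    have "\<alpha> * pi / 2 \<le> pi / 2"
      using assms by simp
    then have "0 < cos \<theta>"
      using r(3) by (intro cos_gt_zero_pi) linarith+
    then have "0 < Re z"
      using r by simp
    then show ?thesis
      by (auto simp: complex_nonpos_Reals_iff)
  qed
  then show ?thesis by blast
qed

lemma posy_principal_of_real:
  assumes "x \<in> pos_orthant"
  shows "posy_principal A c (\<chi> i. of_real (x $ i)) = of_real (posy_eval A c x)"
  using assms
  by (simp add: posy_principal_def posy_eval_def pos_orthant_def powr_of_real less_imp_le)

end

(* In logarithmic coordinates z = exp (\<beta> w) with \<beta> < \<alpha>, the posynomial is an exponential sum Q of
   homogeneity degree D = \<beta> d without zeros on a tube |Im w_i| < \<rho> with \<rho> > pi / 2; let g = log Q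
   be the branch that is real at real points. The main point is |Im g| \<le> D pi / 2 for
   |Im w_i| \<le> pi / 2, which says that h = exp (g / D) maps the product of right half-planes (in the
   variables exp w_i) into the closed right half-plane. The maximum principle in each coordinate
   reduces this to |Im w_i| = pi / 2, i.e. to the argument on Im z = pi of a one-variable sum
   q z = \<Sum> b_k exp (k z) with b_k > 0. There |q z| \<le> |q (z - 2 pi i)| for pi \<le> Im z \<le> 2 pi, by the
   maximum principle again, so that the argument is monotone along Im z = pi, as in the
   Hermite-Biehler theorem.
   Finally h (\<zeta> x + y / \<zeta>) - \<zeta> h x - h y / \<zeta> has nonnegative real part on the imaginary axis and
   vanishes at 0 and infinity; at \<zeta> = 1 this is h x + h y \<le> h (x + y), and a superadditive
   homogeneous function of degree one is concave. *)

theory Submission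
  imports Defs "HOL-Complex_Analysis.Conformal_Mappings"
begin

section \<open>Continuous logarithms and maximum principles on rectangles\<close>

text \<open>Distinct logarithms of one number lie at least \<open>2 * pi\<close> apart, so a
  continuous choice on a connected set cannot jump.\<close>

lemma exp_const_imp_constant_on:
  fixes g :: "'a::topological_space \<Rightarrow> complex"
  assumes "connected S" "continuous_on S g" "\<And>x. x \<in> S \<Longrightarrow> exp (g x) = c"
  shows "g constant_on S"
proof (rule continuous_discrete_range_constant[OF assms(1,2)])
  fix x assume x: "x \<in> S"
  have "2 * pi \<le> norm (g y - g x)" if y: "y \<in> S" "g y \<noteq> g x" for y
  proof -
    have "exp (g y) = exp (g x)" using assms(3) x y by simp
    then have "\<not> \<bar>Im (g y) - Im (g x)\<bar> < 2 * pi"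
      using exp_complex_eqI y by blast
    then show ?thesis
      using abs_Im_le_cmod[of "g y - g x"] by simp
  qed
  then show "\<exists>e>0. \<forall>y. y \<in> S \<and> g y \<noteq> g x \<longrightarrow> e \<le> norm (g y - g x)"
    by (intro exI[of _ "2 * pi"]) auto
qed

text \<open>The difference of two continuous logarithms of one function has exponential
  \<open>1\<close>, hence is constant. Identities between branches are later proved this way:
  exponentiate, then compare at one point.\<close>

lemma exp_eq_imp_eq_on:
  fixes g h :: "'a::topological_space \<Rightarrow> complex"
  assumes "connected S" "continuous_on S g" "continuous_on S h"
    and "\<And>x. x \<in> S \<Longrightarrow> exp (g x) = exp (h x)"
    and "x0 \<in> S" "g x0 = h x0" "x \<in> S"
  shows "g x = h x"
proof -
  have "(\<lambda>x. g x - h x) constant_on S"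
    by (rule exp_const_imp_constant_on[where c = 1])
       (use assms in \<open>auto intro!: continuous_intros simp: exp_diff\<close>)
  then show ?thesis
    using assms(5-7) unfolding constant_on_def by (metis right_minus_eq)
qed

text \<open>Near \<open>z0\<close> the imaginary part of \<open>g z - g z0\<close> is below
  \<open>pi\<close> in absolute value, so this difference is the holomorphic function
  \<open>Ln (f z / f z0)\<close>.\<close>

lemma continuous_log_imp_holomorphic:
  assumes "open S" "continuous_on S g" "f holomorphic_on S"
    and fg: "\<And>z. z \<in> S \<Longrightarrow> exp (g z) = f z"
  shows "g holomorphic_on S"
proof (rule holomorphic_onI)
  fix z0 assume z0: "z0 \<in> S"
  define T where "T = S \<inter> g -` ball (g z0) pi"
  have "open T"
    unfolding T_def using assms(1,2) by (intro continuous_open_preimage) auto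
  have "z0 \<in> T" using z0 by (simp add: T_def)
  have *: "exp (g z - g z0) = f z / f z0" "\<bar>Im (g z - g z0)\<bar> < pi" if "z \<in> T" for z
  proof -
    have "norm (g z - g z0) < pi" "z \<in> S" using that by (auto simp: T_def dist_norm norm_minus_commute)
    then show "\<bar>Im (g z - g z0)\<bar> < pi" "exp (g z - g z0) = f z / f z0"
      using abs_Im_le_cmod[of "g z - g z0"] fg z0 by (auto simp: exp_diff)
  qed
  have nz: "f z0 \<noteq> 0" using fg[OF z0] by (metis exp_not_eq_zero)
  have **: "g z = g z0 + Ln (f z / f z0)" if "z \<in> T" for z
    using *[OF that] Ln_exp[of "g z - g z0"] by auto
  have "f z / f z0 \<notin> \<real>\<^sub>\<le>\<^sub>0" if "z \<in> T" for z
  proof -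
    have "f z / f z0 \<noteq> 0" using *(1)[OF that] by (metis exp_not_eq_zero)
    moreover have "\<bar>Im (Ln (f z / f z0))\<bar> < pi" using *(2)[OF that] **[OF that] by simp
    ultimately show ?thesis
      by (metis Im_Ln_eq_pi abs_of_pos complex_nonpos_Reals_iff complex_is_Real_iff less_irrefl
          order_less_le pi_gt_zero complex_eq_iff zero_complex.simps)
  qed
  then have "(\<lambda>z. g z0 + Ln (f z / f z0)) holomorphic_on T"
    by (intro holomorphic_intros holomorphic_on_subset[OF assms(3)]) (use nz in \<open>auto simp: T_def\<close>)
  then have "g holomorphic_on T"
    using ** by (metis (no_types, lifting) holomorphic_cong)
  then show "g field_differentiable at z0 within S"
    using \<open>open T\<close> \<open>z0 \<in> T\<close> field_differentiable_at_within holomorphic_on_imp_differentiable_at by blast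
qed

lemma open_strip: "open {z. a < Im z \<and> Im z < b}"
  by (simp add: open_halfspace_Im_gt open_halfspace_Im_lt open_Collect_conj)

lemma maximum_modulus_rectangle:
  assumes "f holomorphic_on box p q" "continuous_on (cbox p q) f"
    and "\<And>z. \<lbrakk>z \<in> cbox p q; Re z = Re p \<or> Re z = Re q \<or> Im z = Im p \<or> Im z = Im q\<rbrakk> \<Longrightarrow> norm (f z) \<le> B"
    and "z \<in> cbox p q"
  shows "norm (f z) \<le> B"
proof (rule maximum_modulus_frontier[of f "cbox p q"])
  fix w assume "w \<in> frontier (cbox p q)"
  then have "w \<in> cbox p q" "w \<notin> box p q"
    by (auto simp: frontier_cbox)
  then show "norm (f w) \<le> B"
    using assms(3)[of w] by (auto simp: in_cbox_complex_iff in_box_complex_iff)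
qed (use assms in \<open>auto simp: interior_cbox\<close>)

text \<open>The modulus of \<open>exp (f z)\<close> is \<open>exp (Re (f z))\<close>, which reduces
  real parts to the maximum modulus principle.\<close>

lemma maximum_real_rectangle:
  assumes "f holomorphic_on box p q" "continuous_on (cbox p q) f"
    and "\<And>z. \<lbrakk>z \<in> cbox p q; Re z = Re p \<or> Re z = Re q \<or> Im z = Im p \<or> Im z = Im q\<rbrakk> \<Longrightarrow> Re (f z) \<le> B"
    and "z \<in> cbox p q"
  shows "Re (f z) \<le> B"
proof -
  have "norm (exp (f z)) \<le> exp B"
    by (rule maximum_modulus_rectangle[where f = "\<lambda>z. exp (f z)"])
       (use assms in \<open>auto intro!: holomorphic_intros continuous_intros\<close>)
  then show ?thesis by simp
qed

section \<open>Exponential sums in one variable\<close>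

definition expsum :: "'j set \<Rightarrow> ('j \<Rightarrow> complex) \<Rightarrow> ('j \<Rightarrow> real) \<Rightarrow> complex \<Rightarrow> complex" where
  "expsum J b k z = (\<Sum>j\<in>J. b j * exp (of_real (k j) * z))"

lemma holomorphic_expsum [holomorphic_intros]: "f holomorphic_on S \<Longrightarrow> (\<lambda>z. expsum J b k (f z)) holomorphic_on S"
  unfolding expsum_def by (intro holomorphic_intros)

lemma continuous_expsum [continuous_intros]: "continuous_on S f \<Longrightarrow> continuous_on S (\<lambda>z. expsum J b k (f z))"
  unfolding expsum_def by (intro continuous_intros)

text \<open>Asymptotics are stated only for \<open>Re z\<close> tending to minus infinity; this
  reflection transfers them to the other end.\<close>

lemma expsum_uminus: "expsum J b k (- z) = expsum J b (\<lambda>j. - k j) z"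
  by (simp add: expsum_def)

text \<open>\<open>Re z\<close> tends to minus infinity while \<open>Im z\<close> is unrestricted,
  so limits along this filter are uniform in \<open>Im z\<close>.\<close>

abbreviation re_at_bot :: "complex filter" where "re_at_bot \<equiv> filtercomap Re at_bot"

lemma tendsto_exp_re_at_bot:
  assumes "0 < c"
  shows "((\<lambda>z. exp (of_real c * z)) \<longlongrightarrow> (0::complex)) re_at_bot"
proof (rule tendsto_norm_zero_cancel)
  have "((\<lambda>x. exp (c * x)) \<longlongrightarrow> 0) at_bot"
    by (rule filterlim_compose[OF exp_at_bot])
       (rule filterlim_tendsto_pos_mult_at_bot[OF tendsto_const assms filterlim_ident])
  then have "((\<lambda>z. exp (c * Re z)) \<longlongrightarrow> 0) re_at_bot"
    by (rule filterlim_compose) (rule filterlim_filtercomap)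
  then show "((\<lambda>z. norm (exp (of_real c * z))) \<longlongrightarrow> 0) re_at_bot"
    by simp
qed

text \<open>On the far left the smallest exponent with nonzero total coefficient dominates. Equal
  exponents are grouped first, since complex coefficients may cancel; nonvanishing at
  \<open>z0\<close> guarantees that some group survives.\<close>

lemma expsum_asymptotics:
  assumes J: "finite J" and "expsum J b k z0 \<noteq> 0"
  obtains \<kappa> B where "\<kappa> \<in> k ` J" "B \<noteq> 0"
    "((\<lambda>z. exp (- of_real \<kappa> * z) * expsum J b k z) \<longlongrightarrow> B) re_at_bot"
proof -
  define \<beta> where "\<beta> x = (\<Sum>j | j \<in> J \<and> k j = x. b j)" for x
  define K where "K = {x \<in> k ` J. \<beta> x \<noteq> 0}"
  have K: "finite K" using J by (simp add: K_def)
  have grp: "expsum J b k z = (\<Sum>x\<in>K. \<beta> x * exp (of_real x * z))" for z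
  proof -
    have "expsum J b k z = (\<Sum>x\<in>k ` J. \<Sum>j | j \<in> J \<and> k j = x. b j * exp (of_real (k j) * z))"
      unfolding expsum_def by (rule sum.image_gen[OF J])
    also have "\<dots> = (\<Sum>x\<in>k ` J. \<beta> x * exp (of_real x * z))"
      by (intro sum.cong) (auto simp: \<beta>_def sum_distrib_right)
    also have "\<dots> = (\<Sum>x\<in>K. \<beta> x * exp (of_real x * z))"
      by (rule sum.mono_neutral_right) (use J in \<open>auto simp: K_def\<close>)
    finally show ?thesis .
  qed
  have "K \<noteq> {}" using assms(2) grp[of z0] by auto
  define \<kappa> where "\<kappa> = Min K"
  have \<kappa>: "\<kappa> \<in> K" unfolding \<kappa>_def using K \<open>K \<noteq> {}\<close> by simp
  have lim: "((\<lambda>z. \<beta> x * exp (of_real (x - \<kappa>) * z)) \<longlongrightarrow> (if x = \<kappa> then \<beta> \<kappa> else 0)) re_at_bot"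
    if "x \<in> K" for x
  proof (cases "x = \<kappa>")
    case False
    then have "0 < x - \<kappa>" using that K by (simp add: \<kappa>_def order_less_le)
    from tendsto_mult_right_zero[OF tendsto_exp_re_at_bot[OF this]] show ?thesis using False by simp
  qed auto
  have "((\<lambda>z. \<Sum>x\<in>K. \<beta> x * exp (of_real (x - \<kappa>) * z)) \<longlongrightarrow> (\<Sum>x\<in>K. if x = \<kappa> then \<beta> \<kappa> else 0)) re_at_bot"
    by (intro tendsto_sum lim)
  also have "(\<Sum>x\<in>K. if x = \<kappa> then \<beta> \<kappa> else 0) = \<beta> \<kappa>"
    using K \<kappa> by simp
  also have "(\<lambda>z. \<Sum>x\<in>K. \<beta> x * exp (of_real (x - \<kappa>) * z)) =
      (\<lambda>z. exp (- of_real \<kappa> * z) * expsum J b k z)"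
    by (auto simp: grp sum_distrib_left mult_ac intro!: sum.cong simp flip: exp_add)
       (simp add: algebra_simps)
  finally show thesis
    using that[of \<kappa> "\<beta> \<kappa>"] \<kappa> by (auto simp: K_def)
qed

text \<open>Dividing by the leading term leaves a function \<open>P\<close> tending to
  \<open>1\<close>, and far to the left \<open>L z - \<kappa> z - Ln (P z)\<close> is constant. So
  \<open>Im (L z)\<close> is asymptotically affine in \<open>Im z\<close>, with one slope and one
  constant for the whole strip.\<close>

lemma log_expsum_asymptotics:
  assumes J: "finite J" and "l \<le> u" and "continuous_on {z. l \<le> Im z \<and> Im z \<le> u} L"
    and L: "\<And>z. \<lbrakk>l \<le> Im z; Im z \<le> u\<rbrakk> \<Longrightarrow> exp (L z) = expsum J b k z"
  obtains \<kappa> C where "\<kappa> \<in> k ` J"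
    "((\<lambda>z. Im (L z) - \<kappa> * Im z) \<longlongrightarrow> C) (inf re_at_bot (principal {z. l \<le> Im z \<and> Im z \<le> u}))"
proof -
  let ?S = "{z. l \<le> Im z \<and> Im z \<le> u}"
  have "expsum J b k (\<i> * of_real l) \<noteq> 0"
    using L[of "\<i> * of_real l"] \<open>l \<le> u\<close> by (metis Im_i_times Re_complex_of_real exp_not_eq_zero order_refl)
  then obtain \<kappa> B where \<kappa>: "\<kappa> \<in> k ` J" and B: "B \<noteq> 0"
    and "((\<lambda>z. exp (- of_real \<kappa> * z) * expsum J b k z) \<longlongrightarrow> B) re_at_bot"
    using expsum_asymptotics[OF J] by blast
  define P where "P z = exp (- of_real \<kappa> * z) * expsum J b k z / B" for z
  have P: "(P \<longlongrightarrow> 1) re_at_bot"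
    unfolding P_def using tendsto_divide[OF \<open>(_ \<longlongrightarrow> B) _\<close> tendsto_const B] B by simp
  then have "\<forall>\<^sub>F z in re_at_bot. dist (P z) 1 < 1"
    by (rule tendstoD) simp
  then obtain X where X: "\<And>z. Re z \<le> X \<Longrightarrow> dist (P z) 1 < 1"
    by (auto simp: eventually_filtercomap_at_bot_linorder)
  \<comment> \<open>On this half-strip \<open>P\<close> stays in the right half-plane, away from the
    cut of \<open>Ln\<close>; its convexity supplies connectedness.\<close>
  define H where "H = ?S \<inter> {z. Re z \<le> X}"
  have Ppos: "0 < Re (P z)" if "z \<in> H" for z
  proof -
    have "\<bar>Re (P z - 1)\<bar> < 1"
      using X[of z] that abs_Re_le_cmod[of "P z - 1"] by (auto simp: H_def dist_norm)
    then show ?thesis by simp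
  qed
  have nP: "P z \<notin> \<real>\<^sub>\<le>\<^sub>0" "P z \<noteq> 0" if "z \<in> H" for z
    using Ppos[OF that] by (auto simp: complex_nonpos_Reals_iff)
  have "convex H"
  proof -
    have "H = ({z. l \<le> Im z} \<inter> {z. Im z \<le> u}) \<inter> {z. Re z \<le> X}" by (auto simp: H_def)
    then show ?thesis
      by (simp add: convex_Int convex_halfspace_Im_ge convex_halfspace_Im_le convex_halfspace_Re_le)
  qed
  have "(\<lambda>z. L z - of_real \<kappa> * z - Ln (P z)) constant_on H"
  proof (rule exp_const_imp_constant_on)
    show "connected H" using \<open>convex H\<close> by (rule convex_connected)
    have "continuous_on H P" unfolding P_def by (intro continuous_intros) (use B in auto)
    then show "continuous_on H (\<lambda>z. L z - of_real \<kappa> * z - Ln (P z))"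
      by (intro continuous_intros continuous_on_subset[OF assms(3)]) (use nP in \<open>auto simp: H_def\<close>)
    show "exp (L z - of_real \<kappa> * z - Ln (P z)) = B" if "z \<in> H" for z
    proof -
      have "exp (L z - of_real \<kappa> * z - Ln (P z)) = exp (L z) * exp (- of_real \<kappa> * z) / P z"
        using nP[OF that] by (simp add: exp_diff exp_minus exp_add field_simps)
      also have "\<dots> = exp (- of_real \<kappa> * z) * expsum J b k z / P z"
        using that L by (simp add: H_def)
      also have "exp (- of_real \<kappa> * z) * expsum J b k z = P z * B"
        using B by (simp add: P_def)
      finally show ?thesis using nP[OF that] by simp
    qed
  qed
  then obtain C where C: "\<And>z. z \<in> H \<Longrightarrow> L z - of_real \<kappa> * z - Ln (P z) = C"
    by (auto simp: constant_on_def)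
  have "((\<lambda>z. Im C + Im (Ln (P z))) \<longlongrightarrow> Im C + Im (Ln 1)) re_at_bot"
    by (intro tendsto_intros P) auto
  then have lim: "((\<lambda>z. Im C + Im (Ln (P z))) \<longlongrightarrow> Im C) (inf re_at_bot (principal ?S))"
    by (simp add: tendsto_mono[OF inf_le1])
  have "\<forall>\<^sub>F z in inf re_at_bot (principal ?S). Im C + Im (Ln (P z)) = Im (L z) - \<kappa> * Im z"
    unfolding eventually_inf_principal eventually_filtercomap_at_bot_linorder
  proof (intro exI[of _ X] allI impI)
    fix z assume "Re z \<le> X" "z \<in> ?S"
    then have "Im (L z - of_real \<kappa> * z - Ln (P z)) = Im C" using C[of z] by (simp add: H_def)
    then show "Im C + Im (Ln (P z)) = Im (L z) - \<kappa> * Im z" by simp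
  qed
  with lim have "((\<lambda>z. Im (L z) - \<kappa> * Im z) \<longlongrightarrow> Im C) (inf re_at_bot (principal ?S))"
    by (rule Lim_transform_eventually)
  with \<kappa> show thesis using that by blast
qed

lemma filterlim_Complex_re_at_bot:
  assumes "P y"
  shows "filterlim (\<lambda>x. Complex x y) (inf re_at_bot (principal {z. P (Im z)})) at_bot"
  unfolding filterlim_inf filterlim_principal
  using assms by (auto simp: filterlim_filtercomap_iff o_def filterlim_ident)

text \<open>The limit profile \<open>C + \<kappa> * y\<close> is affine in \<open>y = Im z\<close>,
  so it is bounded by its values at \<open>y = r\<close> and \<open>y = - r\<close>, which are at
  most \<open>M\<close>.\<close>

lemma eventually_Im_log_expsum_le:
  assumes "finite J" "0 \<le> r"
    and "continuous_on {z. - r \<le> Im z \<and> Im z \<le> r} L"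
    and "\<And>z. \<lbrakk>- r \<le> Im z; Im z \<le> r\<rbrakk> \<Longrightarrow> exp (L z) = expsum J b k z"
    and edge: "\<And>z. \<bar>Im z\<bar> = r \<Longrightarrow> Im (L z) \<le> M" and "0 < e"
  obtains X where "\<And>z. \<lbrakk>- r \<le> Im z; Im z \<le> r; Re z \<le> X\<rbrakk> \<Longrightarrow> Im (L z) \<le> M + e"
proof -
  let ?F = "inf re_at_bot (principal {z. - r \<le> Im z \<and> Im z \<le> r})"
  obtain \<kappa> C where C: "((\<lambda>z. Im (L z) - \<kappa> * Im z) \<longlongrightarrow> C) ?F"
    using log_expsum_asymptotics[OF assms(1) _ assms(3,4)] \<open>0 \<le> r\<close> by force
  have *: "C + \<kappa> * y \<le> M" if "\<bar>y\<bar> = r" for y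
  proof -
    have "filterlim (\<lambda>x. Complex x y) ?F at_bot"
      using that by (intro filterlim_Complex_re_at_bot) auto
    from filterlim_compose[OF C this]
    have "((\<lambda>x. Im (L (Complex x y)) - \<kappa> * y) \<longlongrightarrow> C) at_bot" by simp
    then have "C \<le> M - \<kappa> * y"
      by (rule tendsto_upperbound) (use edge that in \<open>auto intro!: always_eventually\<close>)
    then show ?thesis by simp
  qed
  have bound: "C + \<kappa> * y \<le> M" if "\<bar>y\<bar> \<le> r" for y
  proof -
    have "\<kappa> * y \<le> \<bar>\<kappa>\<bar> * r"
      using mult_left_mono[OF that, of "\<bar>\<kappa>\<bar>"] abs_ge_self[of "\<kappa> * y"] by (simp add: abs_mult)
    moreover have "C + \<bar>\<kappa>\<bar> * r \<le> M"
      using *[of r] *[of "- r"] \<open>0 \<le> r\<close> by (cases "0 \<le> \<kappa>") auto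
    ultimately show ?thesis by simp
  qed
  have "\<forall>\<^sub>F z in ?F. dist (Im (L z) - \<kappa> * Im z) C < e"
    using C \<open>0 < e\<close> by (rule tendstoD)
  then obtain X where X: "\<And>z. \<lbrakk>Re z \<le> X; - r \<le> Im z; Im z \<le> r\<rbrakk> \<Longrightarrow> dist (Im (L z) - \<kappa> * Im z) C < e"
    by (auto simp: eventually_inf_principal eventually_filtercomap_at_bot_linorder)
  show thesis
  proof (rule that)
    fix z assume z: "- r \<le> Im z" "Im z \<le> r" "Re z \<le> X"
    then have "\<bar>Im z\<bar> \<le> r" by simp
    then show "Im (L z) \<le> M + e"
      using X[OF z(3,1,2)] bound[of "Im z"] by (simp add: dist_real_def abs_less_iff)
  qed
qed

text \<open>The strip is unbounded, so the maximum principle is applied to \<open>- \<i> * L\<close>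
  on a rectangle so long that its vertical sides satisfy the bound up to \<open>e\<close>.\<close>

lemma Im_log_expsum_le:
  assumes J: "finite J" and "0 \<le> r"
    and cont: "continuous_on {z. - r \<le> Im z \<and> Im z \<le> r} L"
    and hol: "L holomorphic_on {z. - r < Im z \<and> Im z < r}"
    and L: "\<And>z. \<lbrakk>- r \<le> Im z; Im z \<le> r\<rbrakk> \<Longrightarrow> exp (L z) = expsum J b k z"
    and edge: "\<And>z. \<bar>Im z\<bar> = r \<Longrightarrow> Im (L z) \<le> M"
    and z: "- r \<le> Im z" "Im z \<le> r"
  shows "Im (L z) \<le> M"
proof (rule field_le_epsilon)
  fix e :: real assume "0 < e"
  obtain X1 where X1: "\<And>z. \<lbrakk>- r \<le> Im z; Im z \<le> r; Re z \<le> X1\<rbrakk> \<Longrightarrow> Im (L z) \<le> M + e"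
    using eventually_Im_log_expsum_le[OF J \<open>0 \<le> r\<close> cont L edge \<open>0 < e\<close>] by metis
  have cont': "continuous_on {z. - r \<le> Im z \<and> Im z \<le> r} (\<lambda>z. L (- z))"
    by (rule continuous_on_compose2[OF cont]) (auto intro!: continuous_intros)
  have L': "exp (L (- z)) = expsum J b (\<lambda>j. - k j) z" if "- r \<le> Im z" "Im z \<le> r" for z
    using L[of "- z"] that by (simp add: expsum_uminus)
  have edge': "Im (L (- z)) \<le> M" if "\<bar>Im z\<bar> = r" for z
    using edge[of "- z"] that by simp
  obtain X2 where X2: "\<And>z. \<lbrakk>- r \<le> Im z; Im z \<le> r; Re z \<le> X2\<rbrakk> \<Longrightarrow> Im (L (- z)) \<le> M + e"
    using eventually_Im_log_expsum_le[OF J \<open>0 \<le> r\<close> cont' L' edge' \<open>0 < e\<close>] by metis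
  define p where "p = Complex (min (Re z) X1) (- r)"
  define q where "q = Complex (max (Re z) (- X2)) r"
  have "Re (- \<i> * L z) \<le> M + e"
  proof (rule maximum_real_rectangle[where f = "\<lambda>z. - \<i> * L z" and z = z])
    show "(\<lambda>z. - \<i> * L z) holomorphic_on box p q"
      by (intro holomorphic_intros holomorphic_on_subset[OF hol])
         (auto simp: in_box_complex_iff p_def q_def)
    show "continuous_on (cbox p q) (\<lambda>z. - \<i> * L z)"
      by (intro continuous_intros continuous_on_subset[OF cont])
         (auto simp: in_cbox_complex_iff p_def q_def)
    show "z \<in> cbox p q" using z by (auto simp: in_cbox_complex_iff p_def q_def)
    fix w assume w: "w \<in> cbox p q" "Re w = Re p \<or> Re w = Re q \<or> Im w = Im p \<or> Im w = Im q"
    then have "- r \<le> Im w" "Im w \<le> r" by (auto simp: in_cbox_complex_iff p_def q_def)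
    moreover have "Re w \<le> X1 \<or> Re (- w) \<le> X2 \<or> \<bar>Im w\<bar> = r"
      using w(2) \<open>0 \<le> r\<close> by (auto simp: p_def q_def)
    ultimately show "Re (- \<i> * L w) \<le> M + e"
      using X1[of w] X2[of "- w"] edge[of w] \<open>0 < e\<close> by auto
  qed
  then show "Im (L z) \<le> M + e" by simp
qed

text \<open>A vertical shift does not change the modulus of the leading term.\<close>

lemma norm_expsum_shift_ratio_tendsto:
  assumes "finite J" and "expsum J b k z0 \<noteq> 0"
  shows "((\<lambda>z. norm (expsum J b k z / expsum J b k (z - \<i> * of_real y))) \<longlongrightarrow> 1) re_at_bot"
proof -
  obtain \<kappa> B where B: "B \<noteq> 0"
    and lim: "((\<lambda>z. exp (- of_real \<kappa> * z) * expsum J b k z) \<longlongrightarrow> B) re_at_bot"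
    using expsum_asymptotics[OF assms(1,2)] by metis
  have "filterlim (\<lambda>z. z - \<i> * of_real y) re_at_bot re_at_bot"
    by (auto simp: filterlim_filtercomap_iff o_def filterlim_filtercomap)
  note lim' = filterlim_compose[OF lim this]
  have "((\<lambda>z. norm (exp (- of_real \<kappa> * z) * expsum J b k z) /
      norm (exp (- of_real \<kappa> * (z - \<i> * of_real y)) * expsum J b k (z - \<i> * of_real y)))
      \<longlongrightarrow> norm B / norm B) re_at_bot"
    by (intro tendsto_divide tendsto_norm lim lim') (use B in simp)
  then show ?thesis
    using B by (simp add: norm_mult norm_divide)
qed

section \<open>Positive coefficients: reflection at \<open>Im z = pi\<close> and monotonicity of the
  argument\<close>

context
  fixes J :: "'j set" and b k :: "'j \<Rightarrow> real" and \<delta> :: real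
  assumes J: "finite J" and k: "\<And>j. j \<in> J \<Longrightarrow> 0 \<le> k j" and b: "\<And>j. j \<in> J \<Longrightarrow> 0 < b j"
    and \<delta>: "0 < \<delta>"
    and nz: "\<And>z. \<lbrakk>- \<delta> < Im z; Im z < pi + \<delta>\<rbrakk> \<Longrightarrow> expsum J (\<lambda>j. of_real (b j)) k z \<noteq> 0"
begin

abbreviation (input) pexpsum :: "complex \<Rightarrow> complex" where "pexpsum \<equiv> expsum J (\<lambda>j. of_real (b j)) k"

lemma expsum_cnj: "pexpsum (cnj z) = cnj (pexpsum z)"
  by (simp add: expsum_def exp_cnj)

lemma norm_expsum_le_real: "norm (pexpsum z) \<le> norm (pexpsum (of_real (Re z)))"
proof -
  have "norm (pexpsum z) \<le> (\<Sum>j\<in>J. norm (of_real (b j) * exp (of_real (k j) * z)))"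
    unfolding expsum_def by (rule norm_sum)
  also have "\<dots> = (\<Sum>j\<in>J. b j * exp (k j * Re z))"
    using b by (intro sum.cong) (auto simp: norm_mult less_imp_le)
  also have "\<dots> = norm (of_real (\<Sum>j\<in>J. b j * exp (k j * Re z)) :: complex)"
    using b by (subst norm_of_real) (auto intro!: abs_of_nonneg[symmetric] sum_nonneg simp: less_imp_le)
  also have "of_real (\<Sum>j\<in>J. b j * exp (k j * Re z)) = pexpsum (of_real (Re z))"
    by (simp add: expsum_def exp_of_real flip: of_real_mult)
  finally show ?thesis .
qed

text \<open>Maximum principle for the ratio of the two sides: by symmetry it is unimodular on
  \<open>Im z = pi\<close>, on \<open>Im z = 2 * pi\<close> positivity of the coefficients bounds it by \<open>1\<close>, and at both
  ends of the strip the dominant term makes its modulus tend to \<open>1\<close>.\<close>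

lemma norm_expsum_reflect:
  assumes z: "pi \<le> Im z" "Im z \<le> 2 * pi"
  shows "norm (pexpsum z) \<le> norm (pexpsum (z - \<i> * of_real (2 * pi)))"
proof -
  have q0: "pexpsum 0 \<noteq> 0" using nz[of 0] \<delta> pi_gt_zero by (simp add: add_pos_pos)
  \<comment> \<open>The shifted point has imaginary part between \<open>- pi\<close> and
    \<open>0\<close>; its conjugate lies in the zero-free strip.\<close>
  have nz': "pexpsum (w - \<i> * of_real (2 * pi)) \<noteq> 0" if "pi \<le> Im w" "Im w \<le> 2 * pi" for w
  proof -
    have "pexpsum (cnj (w - \<i> * of_real (2 * pi))) \<noteq> 0"
      using that \<delta> by (intro nz) auto
    then show ?thesis by (simp only: expsum_cnj) simp
  qed
  define R where "R w = pexpsum w / pexpsum (w - \<i> * of_real (2 * pi))" for w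
  have "norm (R z) \<le> 1"
  proof (rule field_le_epsilon)
    fix e :: real assume e: "0 < e"
    \<comment> \<open>Kept general in \<open>b\<close>, \<open>k\<close> and \<open>y\<close>: the
      right end uses the exponents \<open>- k j\<close> and the shift
      \<open>- 2 * pi\<close>.\<close>
    have *: "\<exists>X. \<forall>z. Re z \<le> X \<longrightarrow> norm (expsum J b k z / expsum J b k (z - \<i> * of_real y)) \<le> 1 + e"
      if "expsum J b k 0 \<noteq> 0" for y b k
    proof -
      have "\<forall>\<^sub>F z in re_at_bot. norm (expsum J b k z / expsum J b k (z - \<i> * of_real y)) < 1 + e"
        by (rule order_tendstoD(2)[OF norm_expsum_shift_ratio_tendsto[OF J that]]) (use e in simp)
      then show ?thesis
        by (force simp: eventually_filtercomap_at_bot_linorder intro: less_imp_le)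
    qed
    obtain X1 where X1: "\<And>z. Re z \<le> X1 \<Longrightarrow> norm (R z) \<le> 1 + e"
      using *[of "\<lambda>j. of_real (b j)" k "2 * pi"] q0 by (force simp: R_def)
    obtain X2 where X2: "\<And>z. Re z \<le> X2 \<Longrightarrow> norm (R (- z)) \<le> 1 + e"
      using *[of "\<lambda>j. of_real (b j)" "\<lambda>j. - k j" "- 2 * pi"] q0
      by (force simp: R_def simp flip: expsum_uminus)
    define p where "p = Complex (min (Re z) X1) pi"
    define s where "s = Complex (max (Re z) (- X2)) (2 * pi)"
    show "norm (R z) \<le> 1 + e"
    proof (rule maximum_modulus_rectangle[where f = R and z = z])
      show "R holomorphic_on box p s"
        unfolding R_def using nz'
        by (intro holomorphic_intros) (auto simp: in_box_complex_iff p_def s_def)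
      show "continuous_on (cbox p s) R"
        unfolding R_def using nz'
        by (intro continuous_intros) (auto simp: in_cbox_complex_iff p_def s_def)
      show "z \<in> cbox p s" using z by (auto simp: in_cbox_complex_iff p_def s_def)
      fix w assume w: "w \<in> cbox p s" "Re w = Re p \<or> Re w = Re s \<or> Im w = Im p \<or> Im w = Im s"
      consider "Re w \<le> X1" | "Re (- w) \<le> X2" | "Im w = pi" | "Im w = 2 * pi"
        using w(2) by (auto simp: p_def s_def)
      then show "norm (R w) \<le> 1 + e"
      proof cases
        case 1
        then show ?thesis by (rule X1)
      next
        case 2
        then show ?thesis using X2[of "- w"] by simp
      next
        case 3
        then have "w - \<i> * of_real (2 * pi) = cnj w" by (simp add: complex_eq_iff)
        then have "norm (R w) \<le> 1" by (simp add: R_def expsum_cnj norm_divide divide_self_if)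
        then show ?thesis using e by simp
      next
        case 4
        then have "w - \<i> * of_real (2 * pi) = of_real (Re w)" by (simp add: complex_eq_iff)
        then have "norm (R w) \<le> 1"
          using norm_expsum_le_real[of w] by (simp add: R_def norm_divide divide_le_eq_1)
        then show ?thesis using e by simp
      qed
    qed
  qed
  then show ?thesis
    using nz'[OF z] by (simp add: R_def norm_divide divide_le_eq_1)
qed

text \<open>The reflection inequality makes the argument increase along \<open>Im z = pi\<close>, and its limit at the
  left end is \<open>pi\<close> times an exponent.\<close>

lemma Im_log_expsum_nonneg:
  assumes hol: "L holomorphic_on {z. - \<delta> < Im z \<and> Im z < pi + \<delta>}"
    and L: "\<And>z. \<lbrakk>- \<delta> < Im z; Im z < pi + \<delta>\<rbrakk> \<Longrightarrow> exp (L z) = pexpsum z"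
    and real: "\<And>x. Im (L (of_real x)) = 0"
  shows "0 \<le> Im (L (Complex x pi))"
proof -
  let ?S = "{z. - \<delta> < Im z \<and> Im z < pi + \<delta>}"
  have "open ?S" by (rule open_strip)
  have dL: "(L has_field_derivative deriv L z) (at z)" if "z \<in> ?S" for z
    using holomorphic_derivI[OF hol \<open>open ?S\<close> that] by simp
  have pos: "0 \<le> Im (deriv L (Complex x pi))" for x
  proof (rule ccontr)
    assume neg: "\<not> 0 \<le> Im (deriv L (Complex x pi))"
    \<comment> \<open>By the Cauchy-Riemann equations \<open>\<phi>\<close> has derivative
      \<open>- 2 * Im (deriv L (Complex x pi))\<close> at \<open>0\<close>. If this were positive,
      the modulus just above \<open>Im z = pi\<close> would exceed that at the mirror point below,
      against \<open>norm_expsum_reflect\<close>.\<close>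
    define \<phi> where "\<phi> t = Re (L (Complex x (pi + t)) - L (Complex x (pi - t)))" for t
    have inS: "Complex x pi \<in> ?S" using \<delta> pi_gt_zero by (simp add: less_trans[of _ 0])
    have "((\<lambda>t. L (Complex x (pi + s * t))) has_vector_derivative (\<i> * of_real s * deriv L (Complex x pi))) (at 0)" for s
    proof -
      have "((\<lambda>t. Complex x (pi + s * t)) has_vector_derivative (\<i> * of_real s)) (at 0)"
        unfolding Complex_eq by (auto intro!: derivative_eq_intros)
      moreover have "(L has_field_derivative deriv L (Complex x pi)) (at (Complex x (pi + s * 0)))"
        using dL[OF inS] by simp
      ultimately show ?thesis
        using field_vector_diff_chain_at[of "\<lambda>t. Complex x (pi + s * t)" "\<i> * of_real s" 0 L] by (simp add: o_def)
    qed
    from has_vector_derivative_diff[OF this[of 1] this[of "-1"]]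
    have "((\<lambda>t. L (Complex x (pi + t)) - L (Complex x (pi - t))) has_vector_derivative
        (2 * \<i> * deriv L (Complex x pi))) (at 0)"
      by (simp add: mult.assoc)
    then have "(\<phi> has_real_derivative (- 2 * Im (deriv L (Complex x pi)))) (at 0)"
      unfolding \<phi>_def has_real_derivative_iff_has_vector_derivative
      by (auto dest!: bounded_linear.has_vector_derivative[OF bounded_linear_Re])
    from DERIV_pos_inc_right[OF this] neg obtain d where d: "0 < d" "\<And>h. \<lbrakk>0 < h; h < d\<rbrakk> \<Longrightarrow> \<phi> 0 < \<phi> h"
      by force
    \<comment> \<open>Small enough to keep both mirror points in the domain of \<open>L\<close> and
      the upper one below \<open>Im z = 2 * pi\<close>.\<close>
    define h where "h = min (d / 2) (min (\<delta> / 2) (pi / 2))"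
    have h: "0 < h" "h < d" "h < \<delta>" "h < pi"
      using d(1) \<delta> by (auto simp: h_def min_def)
    have "norm (pexpsum (Complex x (pi + h))) \<le> norm (pexpsum (Complex x (pi + h) - \<i> * of_real (2 * pi)))"
      using h by (intro norm_expsum_reflect) auto
    also have "Complex x (pi + h) - \<i> * of_real (2 * pi) = cnj (Complex x (pi - h))"
      by (simp add: complex_eq_iff)
    also have "norm (pexpsum (cnj (Complex x (pi - h)))) = norm (pexpsum (Complex x (pi - h)))"
      by (simp add: expsum_cnj)
    finally have "norm (exp (L (Complex x (pi + h)))) \<le> norm (exp (L (Complex x (pi - h))))"
      using h \<delta> by (subst (1 2) L) auto
    then have "\<phi> h \<le> 0" by (simp add: \<phi>_def)
    then show False using d(2)[OF h(1,2)] by (simp add: \<phi>_def)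
  qed
  define v where "v x = Im (L (Complex x pi))" for x
  have dv: "(v has_real_derivative Im (deriv L (Complex x pi))) (at x)" for x
  proof -
    have "((\<lambda>x. Complex x pi) has_vector_derivative 1) (at x)"
      unfolding Complex_eq by (auto intro!: derivative_eq_intros)
    from field_vector_diff_chain_at[OF this dL[of "Complex x pi"]] \<delta> less_trans[of "- \<delta>" 0 pi]
    have "((\<lambda>x. L (Complex x pi)) has_vector_derivative deriv L (Complex x pi)) (at x)"
      by (simp add: o_def add_pos_pos)
    then show ?thesis
      unfolding v_def has_real_derivative_iff_has_vector_derivative
      by (rule bounded_linear.has_vector_derivative[OF bounded_linear_Im])
  qed
  have mono: "v x \<le> v y" if "x \<le> y" for x y
    using that dv pos by (intro DERIV_nonneg_imp_nondecreasing[of x y v]) blast+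
  have cont: "continuous_on {z. 0 \<le> Im z \<and> Im z \<le> pi} L"
    using holomorphic_on_imp_continuous_on[OF hol] by (rule continuous_on_subset) (use \<delta> in auto)
  have L': "exp (L z) = pexpsum z" if "0 \<le> Im z" "Im z \<le> pi" for z
    using that \<delta> by (intro L) auto
  \<comment> \<open>One strip containing both \<open>Im z = 0\<close> and \<open>Im z = pi\<close>
    gives a common \<open>\<kappa>\<close> and \<open>C\<close>. Reality on the first line forces
    \<open>C = 0\<close>, so the limit on the second is \<open>\<kappa> * pi\<close>.\<close>
  obtain \<kappa> C where \<kappa>: "\<kappa> \<in> k ` J" and
    C: "((\<lambda>z. Im (L z) - \<kappa> * Im z) \<longlongrightarrow> C) (inf re_at_bot (principal {z. 0 \<le> Im z \<and> Im z \<le> pi}))"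
    by (rule log_expsum_asymptotics[OF J pi_ge_zero cont L'])
  have *: "((\<lambda>x. Im (L (Complex x y)) - \<kappa> * y) \<longlongrightarrow> C) at_bot" if "0 \<le> y" "y \<le> pi" for y
    using filterlim_compose[OF C filterlim_Complex_re_at_bot[of "\<lambda>y. 0 \<le> y \<and> y \<le> pi"]] that by simp
  have "((\<lambda>x::real. 0 :: real) \<longlongrightarrow> C) at_bot"
    using *[of 0] real by (simp add: complex_of_real_def)
  then have "C = 0" by (simp add: tendsto_const_iff)
  then have "((\<lambda>x. v x - \<kappa> * pi) \<longlongrightarrow> 0) at_bot" using *[of pi] by (simp add: v_def)
  moreover have "\<forall>\<^sub>F y in at_bot. v y - \<kappa> * pi \<le> v x - \<kappa> * pi"
    using mono by (auto simp: eventually_at_bot_linorder intro!: exI[of _ x])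
  ultimately have "0 \<le> v x - \<kappa> * pi" by (rule tendsto_upperbound) simp
  moreover have "0 \<le> \<kappa> * pi" using \<kappa> k by auto
  ultimately show ?thesis by (simp add: v_def)
qed

end

lemma holomorphic_on_if_0: "(\<lambda>z. if P then z else 0) holomorphic_on T"
  by (cases P) simp_all

lemma continuous_on_if_0: "continuous_on T (\<lambda>z :: complex. if P then z else 0)"
  by (cases P) simp_all

section \<open>Zero-free exponential sums on a tube\<close>

text \<open>The posynomial in logarithmic coordinates. The strict bound on \<open>\<rho>\<close>
  puts the closed tube of half-width \<open>pi / 2\<close> inside the open zero-free tube.\<close>

locale stable_expsum =
  fixes J :: "'j set" and b :: "'j \<Rightarrow> real" and e :: "'j \<Rightarrow> real ^ 'n" and D \<rho> :: real
  assumes J: "finite J" and b: "j \<in> J \<Longrightarrow> 0 < b j" and e: "j \<in> J \<Longrightarrow> 0 \<le> e j $ i"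
    and homog: "j \<in> J \<Longrightarrow> (\<Sum>i\<in>UNIV. e j $ i) = D"
    and D: "0 < D" and \<rho>: "pi / 2 < \<rho>"
    and nonzero: "(\<And>i. \<bar>Im (w $ i)\<bar> < \<rho>) \<Longrightarrow>
      (\<Sum>j\<in>J. of_real (b j) * exp (\<Sum>i\<in>UNIV. of_real (e j $ i) * w $ i)) \<noteq> 0"
begin

definition Q :: "complex ^ 'n \<Rightarrow> complex" where
  "Q w = (\<Sum>j\<in>J. of_real (b j) * exp (\<Sum>i\<in>UNIV. of_real (e j $ i) * w $ i))"

definition Qr :: "real ^ 'n \<Rightarrow> real" where
  "Qr x = (\<Sum>j\<in>J. b j * exp (\<Sum>i\<in>UNIV. e j $ i * x $ i))"

definition tube :: "(complex ^ 'n) set" where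
  "tube = {w. \<forall>i. \<bar>Im (w $ i)\<bar> < \<rho>}"

lemma \<rho>_pos: "0 < \<rho>"
  using \<rho> pi_gt_zero by linarith

lemma Q_nonzero: "w \<in> tube \<Longrightarrow> Q w \<noteq> 0"
  using nonzero[of w] by (simp add: tube_def Q_def)

lemma tubeI: "(\<And>i. \<bar>Im (w $ i)\<bar> \<le> pi / 2) \<Longrightarrow> w \<in> tube"
  unfolding tube_def using \<rho> by (blast intro: le_less_trans)

lemma convex_tube: "convex tube"
proof -
  have "tube = (\<Inter>i. {w. w $ i \<in> {z. - \<rho> < Im z} \<inter> {z. Im z < \<rho>}})"
    by (auto simp: tube_def abs_less_iff minus_less_iff)
  moreover have "convex {w :: complex ^ 'n. w $ i \<in> {z. - \<rho> < Im z} \<inter> {z. Im z < \<rho>}}" for i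
  proof -
    have "linear (\<lambda>w :: complex ^ 'n. w $ i)" by (simp add: linear_iff)
    moreover have "convex ({z. - \<rho> < Im z} \<inter> {z. Im z < \<rho>})"
      by (simp add: convex_Int convex_halfspace_Im_gt convex_halfspace_Im_lt)
    ultimately show ?thesis
      using convex_linear_vimage unfolding vimage_def by blast
  qed
  ultimately show ?thesis by (simp add: convex_INT)
qed

lemma continuous_Q: "continuous_on S Q"
  unfolding Q_def by (intro continuous_intros)

text \<open>Homogeneity: adding \<open>s\<close> to every logarithm multiplies every variable by
  \<open>exp s\<close>.\<close>

lemma Q_shift: "Q (\<chi> i. w $ i + s) = exp (of_real D * s) * Q w"
proof -
  have "exp (\<Sum>i\<in>UNIV. of_real (e j $ i) * (w $ i + s)) =
      exp (of_real D * s) * exp (\<Sum>i\<in>UNIV. of_real (e j $ i) * w $ i)" if "j \<in> J" for j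
    using homog[OF that]
    by (simp add: algebra_simps sum.distrib exp_add flip: sum_distrib_left of_real_sum)
  then show ?thesis
    unfolding Q_def sum_distrib_left by (intro sum.cong) auto
qed

lemma Q_cnj: "Q (\<chi> i. cnj (w $ i)) = cnj (Q w)"
  by (simp add: Q_def exp_cnj)

lemma J_nonempty: "J \<noteq> {}"
proof -
  have "Q 0 \<noteq> 0" using \<rho>_pos by (intro Q_nonzero) (simp add: tube_def)
  then show ?thesis by (auto simp: Q_def)
qed

lemma Qr_pos: "0 < Qr x"
  unfolding Qr_def using J J_nonempty b by (intro sum_pos) auto

lemma Q_of_real: "Q (\<chi> i. of_real (x $ i)) = of_real (Qr x)"
  by (simp add: Q_def Qr_def flip: exp_of_real)

lemma of_real_in_tube: "(\<chi> i. of_real (x $ i)) \<in> tube"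
  using \<rho>_pos by (simp add: tube_def)

text \<open>Reduction to one variable: the coordinates in \<open>S\<close> move together by
  \<open>z\<close>, and the fixed part \<open>w\<close> enters the coefficients.\<close>

lemma Q_add_on:
  "Q (\<chi> i. w $ i + (if i \<in> S then z else 0)) =
    expsum J (\<lambda>j. of_real (b j) * exp (\<Sum>i\<in>UNIV. of_real (e j $ i) * w $ i)) (\<lambda>j. \<Sum>i\<in>S. e j $ i) z"
proof -
  have "(\<Sum>i\<in>UNIV. of_real (e j $ i) * (w $ i + (if i \<in> S then z else 0))) =
      (\<Sum>i\<in>UNIV. of_real (e j $ i) * w $ i) + of_real (\<Sum>i\<in>S. e j $ i) * z" for j
  proof -
    have "(\<Sum>i\<in>UNIV. of_real (e j $ i) * (if i \<in> S then z else 0)) = (\<Sum>i\<in>S. of_real (e j $ i) * z)"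
      by (rule sum.mono_neutral_cong_right) auto
    then show ?thesis by (simp add: distrib_left sum.distrib sum_distrib_right)
  qed
  then show ?thesis by (simp add: Q_def expsum_def exp_add mult_ac)
qed

text \<open>The tube is convex, hence contractible, so a continuous logarithm exists. At real points
  it differs from \<open>ln (Qr x)\<close> by a constant \<open>c\<close> with
  \<open>exp c = 1\<close>, which is subtracted.\<close>

lemma log_branch:
  obtains g where "continuous_on tube g" "\<And>w. w \<in> tube \<Longrightarrow> exp (g w) = Q w"
    "\<And>x. g (\<chi> i. of_real (x $ i)) = of_real (ln (Qr x))"
proof -
  obtain g where g: "continuous_on tube g" "\<And>w. w \<in> tube \<Longrightarrow> Q w = exp (g w)"
    using continuous_logarithm_on_contractible[OF continuous_Q convex_imp_contractible[OF convex_tube]] Q_nonzero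
    by blast
  have "(\<lambda>x. g (\<chi> i. of_real (x $ i)) - of_real (ln (Qr x))) constant_on UNIV"
  proof (rule exp_const_imp_constant_on[where c = 1])
    have "continuous_on UNIV Qr" unfolding Qr_def by (intro continuous_intros)
    then show "continuous_on UNIV (\<lambda>x. g (\<chi> i. of_real (x $ i)) - of_real (ln (Qr x)))"
      using Qr_pos of_real_in_tube
      by (intro continuous_intros continuous_on_compose2[OF g(1)]) (auto simp: less_imp_neq[symmetric])
    show "exp (g (\<chi> i. of_real (x $ i)) - of_real (ln (Qr x))) = 1" for x
      using g(2)[OF of_real_in_tube[of x]] Qr_pos[of x] by (simp add: exp_diff Q_of_real exp_of_real)
  qed (rule connected_UNIV)
  then obtain c where c: "\<And>x. g (\<chi> i. of_real (x $ i)) - of_real (ln (Qr x)) = c"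
    by (auto simp: constant_on_def)
  have "exp c = 1"
    using g(2)[OF of_real_in_tube[of 0]] Qr_pos[of 0] Q_of_real[of 0]
    by (simp add: exp_diff exp_of_real flip: c[of 0])
  show thesis
  proof (rule that[of "\<lambda>w. g w - c"])
    show "continuous_on tube (\<lambda>w. g w - c)" using g(1) by (intro continuous_intros)
    show "exp (g w - c) = Q w" if "w \<in> tube" for w
      using g(2)[OF that] \<open>exp c = 1\<close> by (simp add: exp_diff)
    show "g (\<chi> i. of_real (x $ i)) - c = of_real (ln (Qr x))" for x
      using c[of x] by (simp add: algebra_simps)
  qed
qed

end

section \<open>The branch \<open>g\<close> of \<open>log Q\<close> and the bound on its
  argument\<close>

locale stable_expsum_log = stable_expsum J b e D \<rho>
  for J :: "'j set" and b :: "'j \<Rightarrow> real" and e :: "'j \<Rightarrow> real ^ 'n" and D \<rho> :: real +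
  fixes g :: "complex ^ 'n \<Rightarrow> complex"
  assumes continuous_g: "continuous_on tube g"
    and exp_g: "w \<in> tube \<Longrightarrow> exp (g w) = Q w"
    and g_of_real: "g (\<chi> i. of_real (x $ i)) = of_real (ln (Qr x))"
begin

text \<open>Along the segment from \<open>w\<close> to its shift, which convexity keeps in the tube,
  both sides are continuous logarithms of the same function and agree at the start.\<close>

lemma g_shift:
  assumes "w \<in> tube" "(\<chi> i. w $ i + s) \<in> tube"
  shows "g (\<chi> i. w $ i + s) = g w + of_real D * s"
proof -
  have tube: "(\<chi> i. w $ i + of_real t * s) \<in> tube" if "t \<in> {0..1}" for t
  proof -
    have "(1 - t) *\<^sub>R w + t *\<^sub>R (\<chi> i. w $ i + s) \<in> tube"
      using convex_tube assms that by (auto simp: convex_alt)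
    also have "(1 - t) *\<^sub>R w + t *\<^sub>R (\<chi> i. w $ i + s) = (\<chi> i. w $ i + of_real t * s)"
      by (simp add: vec_eq_iff vector_scaleR_component) (simp add: scaleR_conv_of_real algebra_simps)
    finally show ?thesis .
  qed
  have "g (\<chi> i. w $ i + of_real 1 * s) = g w + of_real D * (of_real 1 * s)"
  proof (rule exp_eq_imp_eq_on[where S = "{0..1::real}"])
    show "continuous_on {0..1} (\<lambda>t. g (\<chi> i. w $ i + of_real t * s))"
      using tube by (intro continuous_on_compose2[OF continuous_g] continuous_intros) auto
    show "exp (g (\<chi> i. w $ i + of_real t * s)) = exp (g w + of_real D * (of_real t * s))"
      if "t \<in> {0..1}" for t
      using exp_g[OF tube[OF that]] exp_g[OF assms(1)] by (simp add: Q_shift exp_add)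
    show "g (\<chi> i. w $ i + of_real 0 * s) = g w + of_real D * (of_real 0 * s)"
      by simp
  qed (auto intro!: continuous_intros)
  then show ?thesis by simp
qed

text \<open>Both sides are continuous logarithms of \<open>cnj (Q w)\<close>, and they agree at the
  origin, where \<open>g\<close> is real.\<close>

lemma g_cnj:
  assumes "w \<in> tube"
  shows "g (\<chi> i. cnj (w $ i)) = cnj (g w)"
proof (rule exp_eq_imp_eq_on[where S = tube])
  show "continuous_on tube (\<lambda>w. g (\<chi> i. cnj (w $ i)))"
    by (intro continuous_on_compose2[OF continuous_g] continuous_intros) (auto simp: tube_def)
  show "exp (g (\<chi> i. cnj (w $ i))) = exp (cnj (g w))" if "w \<in> tube" for w
    using exp_g[of w] exp_g[of "\<chi> i. cnj (w $ i)"] that by (simp add: Q_cnj tube_def flip: exp_cnj)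
  show "(\<chi> i. of_real ((0 :: real ^ 'n) $ i)) \<in> tube" by (rule of_real_in_tube)
  show "g (\<chi> i. cnj ((\<chi> i. of_real ((0 :: real ^ 'n) $ i)) $ i)) = cnj (g (\<chi> i. of_real ((0 :: real ^ 'n) $ i)))"
    unfolding g_of_real using g_of_real[of 0] by simp
qed (use assms convex_tube continuous_g in \<open>auto intro!: continuous_intros convex_connected\<close>)

lemma holomorphic_g:
  assumes "open T" "\<And>i. \<phi> i holomorphic_on T" "\<And>z. z \<in> T \<Longrightarrow> (\<chi> i. \<phi> i z) \<in> tube"
  shows "(\<lambda>z. g (\<chi> i. \<phi> i z)) holomorphic_on T"
proof (rule continuous_log_imp_holomorphic[OF \<open>open T\<close>])
  show "continuous_on T (\<lambda>z. g (\<chi> i. \<phi> i z))"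
    using assms by (intro continuous_on_compose2[OF continuous_g] continuous_intros holomorphic_on_imp_continuous_on) auto
  show "(\<lambda>z. Q (\<chi> i. \<phi> i z)) holomorphic_on T"
    unfolding Q_def using assms(2) by (auto intro!: holomorphic_intros)
  show "exp (g (\<chi> i. \<phi> i z)) = Q (\<chi> i. \<phi> i z)" if "z \<in> T" for z
    using assms(3) that by (intro exp_g)
qed

text \<open>Adding \<open>\<i> * pi / 2\<close> to all coordinates makes their imaginary parts
  \<open>0\<close> or \<open>pi\<close> and, by homogeneity, adds \<open>D * pi / 2\<close> to
  \<open>Im (g w)\<close>. Moving the coordinates in \<open>S\<close> together gives a one-variable
  sum with positive coefficients, and \<open>Im_log_expsum_nonneg\<close> applies at
  \<open>Complex 0 pi\<close>.\<close>

lemma Im_g_corner: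
  assumes w: "\<And>i. \<bar>Im (w $ i)\<bar> = pi / 2"
  shows "- (D * pi / 2) \<le> Im (g w)"
proof -
  define S where "S = {i. Im (w $ i) = pi / 2}"
  define x :: "real ^ 'n" where "x = (\<chi> i. Re (w $ i))"
  \<comment> \<open>The room between \<open>pi / 2\<close> and \<open>\<rho>\<close> becomes the
    zero-free collar around \<open>0 \<le> Im z \<le> pi\<close>.\<close>
  define \<delta> where "\<delta> = \<rho> - pi / 2"
  define v where "v z = (\<chi> i. (of_real (x $ i) + (if i \<in> S then z else 0)) - \<i> * of_real (pi / 2))" for z
  define L where "L z = g (v z) + \<i> * of_real (D * pi / 2)" for z
  have \<delta>: "0 < \<delta>" using \<rho> by (simp add: \<delta>_def)
  have v: "v z \<in> tube" if "- \<delta> < Im z" "Im z < pi + \<delta>" for z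
    using that \<rho> \<rho>_pos by (auto simp: tube_def v_def \<delta>_def abs_less_iff field_simps intro: add_pos_pos)
  let ?q = "expsum J (\<lambda>j. of_real (b j * exp (\<Sum>i\<in>UNIV. e j $ i * x $ i))) (\<lambda>j. \<Sum>i\<in>S. e j $ i)"
  have q: "exp (L z) = ?q z" if "- \<delta> < Im z" "Im z < pi + \<delta>" for z
  proof -
    have "exp (L z) = exp (of_real D * (\<i> * of_real (pi / 2))) * Q (v z)"
      using exp_g[OF v[OF that]] by (simp add: L_def exp_add mult_ac)
    also have "\<dots> = Q (\<chi> i. v z $ i + \<i> * of_real (pi / 2))"
      by (simp only: Q_shift)
    also have "\<dots> = Q (\<chi> i. (\<chi> i. of_real (x $ i)) $ i + (if i \<in> S then z else 0))"
      by (simp add: v_def cong: if_cong)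
    also have "\<dots> = ?q z"
      unfolding Q_add_on by (simp flip: exp_of_real)
    finally show ?thesis .
  qed
  have "0 \<le> Im (L (Complex 0 pi))"
  proof (rule Im_log_expsum_nonneg[OF J _ _ \<delta>])
    show "0 \<le> (\<Sum>i\<in>S. e j $ i)" if "j \<in> J" for j
      using e that by (intro sum_nonneg) auto
    show "0 < b j * exp (\<Sum>i\<in>UNIV. e j $ i * x $ i)" if "j \<in> J" for j
      using b[OF that] by simp
    show "?q z \<noteq> 0" if "- \<delta> < Im z" "Im z < pi + \<delta>" for z
      using q[OF that] by (metis exp_not_eq_zero)
    show "exp (L z) = ?q z" if "- \<delta> < Im z" "Im z < pi + \<delta>" for z
      by (rule q[OF that])
    show "L holomorphic_on {z. - \<delta> < Im z \<and> Im z < pi + \<delta>}"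
      unfolding L_def v_def using v
      by (intro holomorphic_intros holomorphic_g open_strip)
         (auto simp: v_def
               intro!: holomorphic_intros holomorphic_on_if_0)
    show "Im (L (of_real t)) = 0" for t
    proof -
      have vt: "v (of_real t) \<in> tube" using \<delta> by (intro v) (auto simp: add_pos_pos)
      have eq: "(\<chi> i. v (of_real t) $ i + \<i> * of_real (pi / 2)) =
          (\<chi> i. of_real ((\<chi> i. x $ i + (if i \<in> S then t else 0)) $ i))"
        by (simp add: v_def vec_eq_iff)
      have "g (\<chi> i. v (of_real t) $ i + \<i> * of_real (pi / 2)) = L (of_real t)"
        by (subst g_shift[OF vt]) (simp_all only: eq of_real_in_tube, simp add: L_def mult_ac)
      then show ?thesis unfolding eq g_of_real by (metis Im_complex_of_real)
    qed
  qed
  moreover have "v (Complex 0 pi) = w"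
  proof -
    have "Im (w $ i) = - (pi / 2)" if "i \<notin> S" for i
      using w[of i] that by (auto simp: S_def abs_if split: if_splits)
    then show ?thesis
      by (auto simp: v_def vec_eq_iff complex_eq_iff x_def S_def)
  qed
  ultimately show ?thesis by (simp add: L_def)
qed

text \<open>A maximum principle in one coordinate at a time reduces the bound to the corners of
  \<open>{- pi / 2, pi / 2} ^ n\<close>.\<close>

lemma Im_g_le:
  assumes "\<And>i. \<bar>Im (w $ i)\<bar> \<le> pi / 2"
  shows "Im (g w) \<le> D * pi / 2"
  using assms
\<comment> \<open>The measure counts the coordinates off the boundary lines; pushing one of them to
  a boundary line lowers it.\<close>
proof (induction "card {i. \<bar>Im (w $ i)\<bar> \<noteq> pi / 2}" arbitrary: w rule: less_induct)
  case less
  show ?case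
  proof (cases "\<forall>i. \<bar>Im (w $ i)\<bar> = pi / 2")
    case True
    then have "- (D * pi / 2) \<le> Im (g (\<chi> i. cnj (w $ i)))"
      by (intro Im_g_corner) auto
    then show ?thesis using g_cnj[OF tubeI[OF less.prems]] by simp
  next
    case False
    then obtain i0 where i0: "\<bar>Im (w $ i0)\<bar> \<noteq> pi / 2" by blast
    define w0 where "w0 = (\<chi> i. if i = i0 then 0 else w $ i)"
    define v where "v z = (\<chi> i. w0 $ i + (if i \<in> {i0} then z else 0))" for z
    have vw: "v (w $ i0) = w" by (simp add: v_def w0_def vec_eq_iff)
    have v: "v z \<in> tube" if "\<bar>Im z\<bar> \<le> pi / 2" for z
      using that less.prems by (intro tubeI) (auto simp: v_def w0_def)
    have "Im (g (v (w $ i0))) \<le> D * pi / 2"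
    proof (rule Im_log_expsum_le[where L = "\<lambda>z. g (v z)" and z = "w $ i0" and r = "pi / 2", OF J])
      show "continuous_on {z. - (pi / 2) \<le> Im z \<and> Im z \<le> pi / 2} (\<lambda>z. g (v z))"
        using v by (intro continuous_on_compose2[OF continuous_g])
          (auto simp: v_def[abs_def] abs_le_iff intro!: continuous_intros continuous_on_if_0)
      show "(\<lambda>z. g (v z)) holomorphic_on {z. - (pi / 2) < Im z \<and> Im z < pi / 2}"
        using v unfolding v_def
        by (intro holomorphic_g open_strip)
          (auto simp: abs_le_iff
            intro!: holomorphic_intros holomorphic_on_if_0)
      show "exp (g (v z)) = expsum J (\<lambda>j. of_real (b j) * exp (\<Sum>i\<in>UNIV. of_real (e j $ i) * w0 $ i))
          (\<lambda>j. \<Sum>i\<in>{i0}. e j $ i) z" if "- (pi / 2) \<le> Im z" "Im z \<le> pi / 2" for z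
        using exp_g[OF v, of z] that by (simp only: v_def Q_add_on)
      show "Im (g (v z)) \<le> D * pi / 2" if z: "\<bar>Im z\<bar> = pi / 2" for z
      proof (rule less.hyps)
        have "{i. \<bar>Im (v z $ i)\<bar> \<noteq> pi / 2} \<subseteq> {i. \<bar>Im (w $ i)\<bar> \<noteq> pi / 2}"
          using z by (auto simp: v_def w0_def)
        moreover have "i0 \<notin> {i. \<bar>Im (v z $ i)\<bar> \<noteq> pi / 2}"
          using z by (auto simp: v_def w0_def)
        ultimately have "{i. \<bar>Im (v z $ i)\<bar> \<noteq> pi / 2} \<subset> {i. \<bar>Im (w $ i)\<bar> \<noteq> pi / 2}"
          using i0 by blast
        then show "card {i. \<bar>Im (v z $ i)\<bar> \<noteq> pi / 2} < card {i. \<bar>Im (w $ i)\<bar> \<noteq> pi / 2}"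
          by (intro psubset_card_mono) auto
        show "\<bar>Im (v z $ i)\<bar> \<le> pi / 2" for i
          using z less.prems by (auto simp: v_def w0_def)
      qed
    qed (use less.prems[of i0] in auto)
    then show ?thesis by (simp add: vw)
  qed
qed

lemma abs_Im_g_le:
  assumes "\<And>i. \<bar>Im (w $ i)\<bar> \<le> pi / 2"
  shows "\<bar>Im (g w)\<bar> \<le> D * pi / 2"
proof -
  have "w \<in> tube" by (rule tubeI[OF assms])
  then have "- Im (g w) \<le> D * pi / 2"
    using Im_g_le[of "\<chi> i. cnj (w $ i)"] assms by (simp add: g_cnj)
  then show ?thesis using Im_g_le[OF assms] by (simp add: abs_le_iff)
qed

end

section \<open>Superadditivity of the root \<open>h\<close>\<close>

lemma Im_Ln_less_pi_half:
  assumes "0 < Re z"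
  shows "\<bar>Im (Ln z)\<bar> < pi / 2"
proof -
  have "z \<noteq> 0" using assms by auto
  then show ?thesis using Re_Ln_pos_lt assms by blast
qed

context stable_expsum_log
begin

text \<open>For positive \<open>x\<close>, the sum in the original variables raised to the power
  \<open>1 / D\<close>.\<close>

definition h :: "real ^ 'n \<Rightarrow> real" where
  "h x = exp (ln (Qr (\<chi> i. ln (x $ i))) / D)"

text \<open>With \<open>\<zeta> = exp s\<close> this is the holomorphic extension of \<open>h\<close> to the point \<open>\<zeta> x + y / \<zeta>\<close>, which
  has coordinates in the right half-plane if \<open>\<zeta>\<close> is there. It behaves like \<open>h x * \<zeta>\<close> at infinity
  and like \<open>h y / \<zeta>\<close> at \<open>0\<close>, and \<open>Re \<zeta>\<close> and \<open>Re (1 / \<zeta>)\<close> vanish on the imaginary axis.\<close>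

definition \<kappa> :: "real ^ 'n \<Rightarrow> real ^ 'n \<Rightarrow> complex \<Rightarrow> complex" where
  "\<kappa> x y s = exp (g (\<chi> i. Ln (exp s * of_real (x $ i) + exp (- s) * of_real (y $ i))) / of_real D)"

lemma \<kappa>_commute: "\<kappa> x y (- s) = \<kappa> y x s"
  by (simp add: \<kappa>_def add.commute)

context
  fixes x y :: "real ^ 'n"
  assumes x: "0 < x $ i" and y: "0 < y $ i"
begin

lemma Re_chord_pos:
  assumes "\<bar>Im s\<bar> < pi / 2"
  shows "0 < Re (exp s * of_real (x $ i) + exp (- s) * of_real (y $ i))"
proof -
  have "0 < cos (Im s)" using assms by (intro cos_gt_zero_pi) auto
  then show ?thesis using x[of i] y[of i] by (simp add: Re_exp add_pos_pos)
qed

lemma chord_in_tube: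
  assumes "\<bar>Im s\<bar> < pi / 2"
  shows "(\<chi> i. Ln (exp s * of_real (x $ i) + exp (- s) * of_real (y $ i))) \<in> tube"
  using Im_Ln_less_pi_half[OF Re_chord_pos[OF assms]] by (intro tubeI) (simp add: less_imp_le)

lemma holomorphic_\<kappa>: "\<kappa> x y holomorphic_on {s. - (pi / 2) < Im s \<and> Im s < pi / 2}"
proof -
  have "exp s * of_real (x $ i) + exp (- s) * of_real (y $ i) \<notin> \<real>\<^sub>\<le>\<^sub>0"
    if "- (pi / 2) < Im s" "Im s < pi / 2" for s i
  proof -
    have "\<bar>Im s\<bar> < pi / 2" using that by linarith
    from Re_chord_pos[OF this, of i] show ?thesis by (auto simp: complex_nonpos_Reals_iff)
  qed
  then show ?thesis
    unfolding \<kappa>_def using D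
    by (intro holomorphic_intros holomorphic_g open_strip chord_in_tube) (auto simp: abs_less_iff)
qed

text \<open>Dividing the bound \<open>D * pi / 2\<close> on the argument by \<open>D\<close> leaves
  an angle of at most \<open>pi / 2\<close>.\<close>

lemma Re_\<kappa>_nonneg:
  assumes "\<bar>Im s\<bar> < pi / 2"
  shows "0 \<le> Re (\<kappa> x y s)"
proof -
  let ?w = "\<chi> i. Ln (exp s * of_real (x $ i) + exp (- s) * of_real (y $ i))"
  have "\<bar>Im (g ?w)\<bar> \<le> D * pi / 2"
    using Im_Ln_less_pi_half[OF Re_chord_pos[OF assms]] by (intro abs_Im_g_le) (simp add: less_imp_le)
  then have "\<bar>Im (g ?w) / D\<bar> \<le> pi / 2"
    using D by (simp add: field_simps abs_le_iff)
  then have "0 \<le> cos (Im (g ?w) / D)"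
    by (intro cos_ge_zero) linarith+
  then show ?thesis by (simp add: \<kappa>_def Re_exp)
qed

lemma \<kappa>_0: "\<kappa> x y 0 = of_real (h (x + y))"
proof -
  have *: "(\<chi> i. Ln (exp 0 * of_real (x $ i) + exp (- 0) * of_real (y $ i))) =
      (\<chi> i. of_real ((\<chi> i. ln ((x + y) $ i)) $ i))"
    using x y by (simp add: vec_eq_iff Ln_of_real add_pos_pos flip: of_real_add)
  then show ?thesis
    unfolding \<kappa>_def * g_of_real by (simp add: h_def plus_vec_def flip: exp_of_real)
qed

text \<open>By homogeneity \<open>\<kappa> x y s = exp s * N (exp (- 2 * s))\<close> with
  \<open>N\<close> holomorphic near \<open>0\<close> and \<open>N 0 = h x\<close>, so the error is
  of order \<open>exp (- Re s)\<close>.\<close>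

lemma \<kappa>_asymptotics:
  assumes "0 < \<epsilon>"
  obtains X where
    "\<And>s. \<lbrakk>\<bar>Im s\<bar> < pi / 2; X \<le> Re s\<rbrakk> \<Longrightarrow> norm (\<kappa> x y s - of_real (h x) * exp s) \<le> \<epsilon>"
proof -
  \<comment> \<open>An open neighbourhood of \<open>0\<close> for the variable
    \<open>\<omega> = exp (- 2 * s)\<close>.\<close>
  define T where "T = {\<omega>. \<forall>i. 0 < Re (of_real (x $ i) + \<omega> * of_real (y $ i))}"
  define V where "V \<omega> = (\<chi> i. Ln (of_real (x $ i) + \<omega> * of_real (y $ i)))" for \<omega>
  define N where "N \<omega> = exp (g (V \<omega>) / of_real D)" for \<omega>
  have "T = (\<Inter>i. {\<omega>. 0 < Re (of_real (x $ i) + \<omega> * of_real (y $ i))})"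
    by (auto simp: T_def)
  moreover have "open (\<Inter>i. {\<omega>. 0 < Re (of_real (x $ i) + \<omega> * of_real (y $ i))})"
    by (intro open_INT ballI finite open_Collect_less continuous_intros)
  ultimately have "open T" by simp
  have "0 \<in> T" using x by (simp add: T_def)
  have small: "\<bar>Im (V \<omega> $ i)\<bar> < pi / 2" if "\<omega> \<in> T" for \<omega> i
    using that Im_Ln_less_pi_half by (simp add: T_def V_def)
  have V: "V \<omega> \<in> tube" if "\<omega> \<in> T" for \<omega>
    using small[OF that] by (intro tubeI) (simp add: less_imp_le)
  have nonpos: "of_real (x $ i) + \<omega> * of_real (y $ i) \<notin> \<real>\<^sub>\<le>\<^sub>0" if "\<omega> \<in> T" for \<omega> i
  proof -
    have "0 < Re (of_real (x $ i) + \<omega> * of_real (y $ i))" using that unfolding T_def by blast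
    then show ?thesis by (auto simp: complex_nonpos_Reals_iff)
  qed
  have "N holomorphic_on T"
    unfolding N_def using V nonpos D \<open>open T\<close> unfolding V_def
    by (intro holomorphic_intros holomorphic_g) auto
  then have "N field_differentiable at 0"
    using \<open>open T\<close> \<open>0 \<in> T\<close> holomorphic_on_imp_differentiable_at by blast
  then obtain N' where "(N has_field_derivative N') (at 0)"
    by (auto simp: field_differentiable_def)
  then have "((\<lambda>\<omega>. (N \<omega> - N 0) / \<omega>) \<longlongrightarrow> N') (at 0)"
    by (simp add: has_field_derivative_iff)
  then have "\<forall>\<^sub>F \<omega> in at 0. norm ((N \<omega> - N 0) / \<omega>) < norm N' + 1"
    by (intro order_tendstoD(2)[OF tendsto_norm]) auto
  moreover have "\<forall>\<^sub>F \<omega> in at 0. \<omega> \<in> T"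
    using \<open>open T\<close> \<open>0 \<in> T\<close> by (rule eventually_at_in_open')
  ultimately have "\<forall>\<^sub>F \<omega> in at 0. \<omega> \<in> T \<and> norm ((N \<omega> - N 0) / \<omega>) < norm N' + 1"
    by eventually_elim simp
  then obtain r where r: "0 < r" "\<And>\<omega>. \<lbrakk>\<omega> \<noteq> 0; norm \<omega> < r\<rbrakk> \<Longrightarrow>
      \<omega> \<in> T \<and> norm ((N \<omega> - N 0) / \<omega>) < norm N' + 1"
    by (auto simp: eventually_at)
  have N0: "N 0 = of_real (h x)"
  proof -
    have "V 0 = (\<chi> i. of_real ((\<chi> i. ln (x $ i)) $ i))"
      using x by (simp add: V_def vec_eq_iff Ln_of_real)
    then show ?thesis unfolding N_def by (simp only: g_of_real) (simp add: h_def flip: exp_of_real)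
  qed
  have eq: "\<kappa> x y s = exp s * N (exp (- 2 * s))" if s: "\<bar>Im s\<bar> < pi / 2" and T: "exp (- 2 * s) \<in> T" for s
  proof -
    let ?\<omega> = "exp (- 2 * s)"
    have *: "(\<chi> i. Ln (exp s * of_real (x $ i) + exp (- s) * of_real (y $ i))) = (\<chi> i. V ?\<omega> $ i + s)"
    proof (simp only: vec_eq_iff vec_lambda_beta, intro allI)
      fix i
      let ?u = "exp s * of_real (x $ i) + exp (- s) * of_real (y $ i)"
      have "exp (- s) = exp s * ?\<omega>" by (simp flip: exp_add)
      then have "?u = exp s * (of_real (x $ i) + ?\<omega> * of_real (y $ i))"
        by (simp add: algebra_simps)
      moreover have "?u \<noteq> 0" using Re_chord_pos[OF s, of i] by force
      moreover have "of_real (x $ i) + ?\<omega> * of_real (y $ i) \<noteq> 0" using nonpos[OF T, of i] by auto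
      ultimately have "exp (Ln ?u) = exp (V ?\<omega> $ i + s)" by (simp add: V_def exp_add)
      \<comment> \<open>Three angles, each below \<open>pi / 2\<close>, add up to less than
        \<open>2 * pi\<close>.\<close>
      moreover have "\<bar>Im (Ln ?u) - Im (V ?\<omega> $ i + s)\<bar> < 2 * pi"
        using Im_Ln_less_pi_half[OF Re_chord_pos[OF s, of i]] small[OF T, of i] s
        unfolding plus_complex.sel by linarith
      ultimately show "Ln ?u = V ?\<omega> $ i + s"
        using exp_complex_eqI by blast
    qed
    have "g (\<chi> i. V ?\<omega> $ i + s) = g (V ?\<omega>) + of_real D * s"
      using V[OF T] chord_in_tube[OF s] unfolding * by (rule g_shift)
    then show ?thesis
      unfolding \<kappa>_def * using D by (simp add: N_def add_divide_distrib exp_add)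
  qed
  define C where "C = norm N' + 1"
  have "0 < C" by (simp add: C_def add_nonneg_pos)
  have "((\<lambda>t. exp (- t)) \<longlongrightarrow> 0) (at_top :: real filter)"
    by (rule filterlim_compose[OF exp_at_bot filterlim_uminus_at_bot_at_top])
  \<comment> \<open>The bound \<open>1\<close> makes the modulus of \<open>\<omega>\<close> at most
    \<open>exp (- Re s)\<close>, \<open>r\<close> puts \<open>\<omega>\<close> where the difference
    quotient is below \<open>C\<close>, and \<open>\<epsilon> / C\<close> gives the final
    estimate.\<close>
  then have "\<forall>\<^sub>F t in at_top. exp (- t) < min (min 1 r) (\<epsilon> / C)"
    by (rule order_tendstoD(2)) (use r assms \<open>0 < C\<close> in auto)
  then obtain X where X: "\<And>t. X \<le> t \<Longrightarrow> exp (- t) < min (min 1 r) (\<epsilon> / C)"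
    by (auto simp: eventually_at_top_linorder)
  show thesis
  proof (rule that)
    fix s assume s: "\<bar>Im s\<bar> < pi / 2" "X \<le> Re s"
    let ?\<omega> = "exp (- 2 * s)"
    have t: "exp (- Re s) < 1" "exp (- Re s) < r" "exp (- Re s) < \<epsilon> / C"
      using X[OF s(2)] by auto
    have "norm ?\<omega> = exp (- Re s) * exp (- Re s)" by (simp flip: exp_add)
    also have "\<dots> \<le> exp (- Re s)" using t(1) by (intro mult_left_le) auto
    finally have "norm ?\<omega> < r" using t(2) by (rule le_less_trans)
    then have \<omega>: "?\<omega> \<in> T" "norm ((N ?\<omega> - N 0) / ?\<omega>) < C"
      using r(2)[of ?\<omega>] by (auto simp: C_def)
    have "\<kappa> x y s - of_real (h x) * exp s = exp s * (N ?\<omega> - N 0)"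
      unfolding eq[OF s(1) \<omega>(1)] N0 by (simp add: algebra_simps)
    also have "\<dots> = exp s * ?\<omega> * ((N ?\<omega> - N 0) / ?\<omega>)"
      by simp
    finally have "norm (\<kappa> x y s - of_real (h x) * exp s) = norm (exp s * ?\<omega> * ((N ?\<omega> - N 0) / ?\<omega>))"
      by (rule arg_cong)
    also have "\<dots> = exp (- Re s) * norm ((N ?\<omega> - N 0) / ?\<omega>)"
      by (simp only: norm_mult norm_exp_eq_Re flip: exp_add) simp
    also have "\<dots> \<le> exp (- Re s) * C" using \<omega>(2) by (intro mult_left_mono) auto
    also have "\<dots> \<le> \<epsilon>"
      using t(3) \<open>0 < C\<close> by (simp add: pos_less_divide_eq less_imp_le)
    finally show "norm (\<kappa> x y s - of_real (h x) * exp s) \<le> \<epsilon>" .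
  qed
qed

end

lemma h_nonneg: "0 \<le> h x"
  by (simp add: h_def)

text \<open>The maximum principle is applied to \<open>Re M\<close>, whose value at \<open>0\<close>
  is \<open>h x + h y - h (x + y)\<close>. The vertical sides use the asymptotics of
  \<open>\<kappa>\<close>, the horizontal ones \<open>Re_\<kappa>_nonneg\<close> and the smallness
  of \<open>cos (Im s)\<close>.\<close>

lemma h_superadditive:
  assumes x: "\<And>i. 0 < x $ i" and y: "\<And>i. 0 < y $ i"
  shows "h x + h y \<le> h (x + y)"
proof (rule field_le_epsilon)
  fix \<epsilon>' :: real assume "0 < \<epsilon>'"
  \<comment> \<open>Two errors of size \<open>\<epsilon>\<close> add up on the vertical
    sides.\<close>
  define \<epsilon> where "\<epsilon> = \<epsilon>' / 2"
  have \<epsilon>: "0 < \<epsilon>" using \<open>0 < \<epsilon>'\<close> by (simp add: \<epsilon>_def)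
  obtain X1 where X1: "\<And>s. \<lbrakk>\<bar>Im s\<bar> < pi / 2; X1 \<le> Re s\<rbrakk> \<Longrightarrow> norm (\<kappa> x y s - of_real (h x) * exp s) \<le> \<epsilon>"
    using \<kappa>_asymptotics[of x y, OF x y \<epsilon>] by blast
  obtain X2 where X2: "\<And>s. \<lbrakk>\<bar>Im s\<bar> < pi / 2; X2 \<le> Re s\<rbrakk> \<Longrightarrow> norm (\<kappa> y x s - of_real (h y) * exp s) \<le> \<epsilon>"
    using \<kappa>_asymptotics[of y x, OF y x \<epsilon>] by blast
  define H where "H = h x + h y"
  have H: "0 \<le> H" "h x \<le> H" "h y \<le> H" using h_nonneg[of x] h_nonneg[of y] by (auto simp: H_def)
  have "((\<lambda>t. H * exp (- t)) \<longlongrightarrow> H * 0) (at_top :: real filter)"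
    by (intro tendsto_mult tendsto_const filterlim_compose[OF exp_at_bot filterlim_uminus_at_bot_at_top])
  then have "\<forall>\<^sub>F t in at_top. H * exp (- t) < \<epsilon>"
    using \<epsilon> by (intro order_tendstoD(2)) auto
  moreover have "\<forall>\<^sub>F t :: real in at_top. max 0 (max X1 X2) \<le> t"
    by (rule eventually_ge_at_top)
  ultimately have "\<forall>\<^sub>F t in at_top. H * exp (- t) < \<epsilon> \<and> max 0 (max X1 X2) \<le> t"
    by eventually_elim simp
  then obtain X where X: "H * exp (- X) < \<epsilon>" "0 \<le> X" "X1 \<le> X" "X2 \<le> X"
    by (auto simp: eventually_at_top_linorder)
  \<comment> \<open>Chosen after \<open>X\<close>: on the horizontal sides
    \<open>cos (Im s) = sin \<eta> \<le> \<eta>\<close> must compensate the factor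
    \<open>exp X\<close>. The \<open>1\<close> added to \<open>H\<close> makes the denominator
    positive from \<open>0 \<le> H\<close> alone.\<close>
  define \<eta> where "\<eta> = min (pi / 4) (\<epsilon> / ((H + 1) * exp X))"
  have \<eta>: "0 < \<eta>" "\<eta> < pi / 2" "\<eta> * ((H + 1) * exp X) \<le> \<epsilon>"
  proof -
    show "0 < \<eta>" using \<epsilon> H(1) by (simp add: \<eta>_def)
    have "\<eta> \<le> pi / 4" unfolding \<eta>_def by (rule min.cobounded1)
    then show "\<eta> < pi / 2" using pi_gt_zero by linarith
    have "\<eta> \<le> \<epsilon> / ((H + 1) * exp X)" by (simp add: \<eta>_def)
    then show "\<eta> * ((H + 1) * exp X) \<le> \<epsilon>" using H(1) by (simp add: pos_le_divide_eq)
  qed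
  define M where "M s = of_real (h x) * exp s + of_real (h y) * exp (- s) - \<kappa> x y s" for s
  define p where "p = Complex (- X) (\<eta> - pi / 2)"
  define q where "q = Complex X (pi / 2 - \<eta>)"
  have strip: "\<bar>Im s\<bar> < pi / 2" if "s \<in> cbox p q" for s
    using that \<eta>(1) by (auto simp: in_cbox_complex_iff p_def q_def)
  have hol: "M holomorphic_on {s. - (pi / 2) < Im s \<and> Im s < pi / 2}"
    unfolding M_def using holomorphic_\<kappa>[of x y, OF x y] by (intro holomorphic_intros) auto
  have "Re (M 0) \<le> 2 * \<epsilon>"
  proof (rule maximum_real_rectangle[where f = M and z = 0])
    show "M holomorphic_on box p q"
      by (rule holomorphic_on_subset[OF hol]) (use \<eta>(1) in \<open>auto simp: in_box_complex_iff p_def q_def\<close>)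
    show "continuous_on (cbox p q) M"
      by (rule continuous_on_subset[OF holomorphic_on_imp_continuous_on[OF hol]])
         (use \<eta>(1) in \<open>auto simp: in_cbox_complex_iff p_def q_def\<close>)
    show "0 \<in> cbox p q" using X \<eta> by (auto simp: in_cbox_complex_iff p_def q_def)
    fix s assume s: "s \<in> cbox p q" "Re s = Re p \<or> Re s = Re q \<or> Im s = Im p \<or> Im s = Im q"
    have half: "Re (a - b) \<le> norm (b - a)" for a b :: complex
      by (metis complex_Re_le_cmod norm_minus_commute)
    consider "Re s = X" | "Re s = - X" | "\<bar>Im s\<bar> = pi / 2 - \<eta>"
      using s(2) \<eta> by (auto simp: p_def q_def)
    then show "Re (M s) \<le> 2 * \<epsilon>"
    proof cases
      case 1
      have "Re (of_real (h y) * exp (- s)) \<le> norm (of_real (h y) * exp (- s))" by (rule complex_Re_le_cmod)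
      also have "\<dots> \<le> H * exp (- X)" using 1 H h_nonneg[of y] by (simp add: norm_mult mult_right_mono)
      finally have "Re (of_real (h y) * exp (- s)) \<le> \<epsilon>" using X(1) by simp
      moreover have "norm (\<kappa> x y s - of_real (h x) * exp s) \<le> \<epsilon>"
        using X1[OF strip[OF s(1)]] 1 X by simp
      ultimately show ?thesis
        using half[of "of_real (h x) * exp s" "\<kappa> x y s"] by (simp add: M_def)
    next
      case 2
      have "Re (of_real (h x) * exp s) \<le> norm (of_real (h x) * exp s)" by (rule complex_Re_le_cmod)
      also have "\<dots> \<le> H * exp (- X)" using 2 H h_nonneg[of x] by (simp add: norm_mult mult_right_mono)
      finally have "Re (of_real (h x) * exp s) \<le> \<epsilon>" using X(1) by simp
      moreover have "norm (\<kappa> x y s - of_real (h y) * exp (- s)) \<le> \<epsilon>"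
        using X2[of "- s"] strip[OF s(1)] 2 X by (simp add: \<kappa>_commute)
      ultimately show ?thesis
        using half[of "of_real (h y) * exp (- s)" "\<kappa> x y s"] by (simp add: M_def)
    next
      case 3
      have "cos (Im s) = cos \<bar>Im s\<bar>" by simp
      also have "\<dots> = sin \<eta>" unfolding 3 by (simp add: cos_diff)
      also have "\<dots> \<le> \<eta>" using \<eta>(1) by (intro sin_x_le_x) simp
      finally have cos: "cos (Im s) \<le> \<eta>" .
      have "0 \<le> cos (Im s)" using strip[OF s(1)] by (intro cos_ge_zero) auto
      have le: "exp (Re s) \<le> exp X" "exp (- Re s) \<le> exp X"
        using s(1) by (auto simp: in_cbox_complex_iff p_def q_def)
      have "Re (M s) \<le> Re (of_real (h x) * exp s) + Re (of_real (h y) * exp (- s))"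
        using Re_\<kappa>_nonneg[of x y, OF x y strip[OF s(1)]] by (simp add: M_def)
      also have "\<dots> = cos (Im s) * (h x * exp (Re s) + h y * exp (- Re s))"
        by (simp add: Re_exp algebra_simps)
      also have "\<dots> \<le> \<eta> * (h x * exp X + h y * exp X)"
        using cos le h_nonneg[of x] h_nonneg[of y] \<eta>(1) \<open>0 \<le> cos (Im s)\<close>
        by (intro mult_mono add_mono mult_nonneg_nonneg add_nonneg_nonneg) auto
      also have "\<dots> \<le> \<eta> * ((H + 1) * exp X)"
        using \<eta>(1) by (intro mult_left_mono) (auto simp: H_def algebra_simps)
      finally show ?thesis using \<eta>(3) \<epsilon> by simp
    qed
  qed
  then show "h x + h y \<le> h (x + y) + \<epsilon>'"
    using \<kappa>_0[of x y, OF x y] by (simp add: M_def \<epsilon>_def)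
qed

end

section \<open>Posynomials\<close>

lemma concave_onI:
  assumes "\<And>t x y. \<lbrakk>0 < t; t < 1; x \<in> S; y \<in> S\<rbrakk> \<Longrightarrow> (1 - t) * f x + t * f y \<le> f ((1 - t) *\<^sub>R x + t *\<^sub>R y)"
    and "convex S"
  shows "concave_on S f"
  unfolding concave_on_def using assms by (intro convex_onI) force+

lemma posy_eval_powr:
  assumes "x \<in> pos_orthant"
  shows "posy_eval A c (\<chi> i. (x $ i) powr \<gamma>) = (\<Sum>a\<in>A. c a * exp (\<Sum>i\<in>UNIV. \<gamma> * a $ i * ln (x $ i)))"
  using assms unfolding posy_eval_def pos_orthant_def
  by (intro sum.cong) (auto simp: exp_sum powr_def less_imp_neq[symmetric] mult_ac intro!: prod.cong)

lemma posy_eval_scale: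
  assumes "homogeneous_of_degree d A" "x \<in> pos_orthant" "0 < t"
  shows "posy_eval A c (\<chi> i. ((t *\<^sub>R x) $ i) powr \<gamma>) = t powr (\<gamma> * d) * posy_eval A c (\<chi> i. (x $ i) powr \<gamma>)"
proof -
  have "t *\<^sub>R x \<in> pos_orthant" using assms by (simp add: pos_orthant_def)
  have "exp (\<Sum>i\<in>UNIV. \<gamma> * a $ i * ln ((t *\<^sub>R x) $ i)) =
      t powr (\<gamma> * d) * exp (\<Sum>i\<in>UNIV. \<gamma> * a $ i * ln (x $ i))" if "a \<in> A" for a
  proof -
    have "(\<Sum>i\<in>UNIV. \<gamma> * a $ i * ln ((t *\<^sub>R x) $ i)) =
        (\<Sum>i\<in>UNIV. \<gamma> * ln t * a $ i + \<gamma> * a $ i * ln (x $ i))"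
      using assms(2,3) by (intro sum.cong) (auto simp: pos_orthant_def ln_mult less_imp_neq[symmetric] algebra_simps)
    also have "\<dots> = \<gamma> * d * ln t + (\<Sum>i\<in>UNIV. \<gamma> * a $ i * ln (x $ i))"
      using assms(1) that by (simp add: sum.distrib homogeneous_of_degree_def flip: sum_distrib_left)
    finally show ?thesis using assms(3) by (simp add: exp_add powr_def)
  qed
  then show ?thesis
    using assms(2) \<open>t *\<^sub>R x \<in> pos_orthant\<close>
    by (simp only: posy_eval_powr sum_distrib_left) (auto intro!: sum.cong simp: mult_ac)
qed

lemma posy_eval_pos:
  assumes "posynomial A c" "A \<noteq> {}" "x \<in> pos_orthant"
  shows "0 < posy_eval A c (\<chi> i. (x $ i) powr \<gamma>)"
  using assms by (subst posy_eval_powr) (auto simp: posynomial_def intro!: sum_pos)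

text \<open>The empty sum vanishes at the point \<open>1\<close> of the sector. Nonemptiness makes
  the posynomial strictly positive.\<close>

lemma sector_stable_nonempty:
  assumes "0 < \<alpha>" "sector_stable \<alpha> A c"
  shows "A \<noteq> {}"
proof
  assume "A = {}"
  have "1 \<in> sector \<alpha>"
    using assms(1) unfolding sector_def by (intro CollectI exI[of _ "1 :: real"] exI[of _ "0 :: real"]) simp
  then have "posy_principal A c 1 \<noteq> 0" using assms(2) by (simp add: sector_stable_def)
  then show False using \<open>A = {}\<close> by (simp add: posy_principal_def)
qed

text \<open>The substitution \<open>z = exp (\<beta> w)\<close> maps the tube into the sector. Since
  \<open>\<alpha> \<le> 1\<close>, the principal logarithm returns \<open>\<beta> w\<close>, so the
  principal branch becomes the exponential sum.\<close>

lemma sector_stable_expsum_nonzero: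
  fixes A :: "(real ^ 'n) set" and w :: "complex ^ 'n"
  assumes "0 < \<beta>" "\<beta> < \<alpha>" "\<alpha> \<le> 1" and stable: "sector_stable \<alpha> A c"
    and w: "\<And>i. \<bar>Im (w $ i)\<bar> < \<alpha> * pi / (2 * \<beta>)"
  shows "(\<Sum>a\<in>A. of_real (c a) * exp (\<Sum>i\<in>UNIV. of_real ((\<beta> *\<^sub>R a) $ i) * w $ i)) \<noteq> 0"
proof -
  define z :: "complex ^ 'n" where "z = (\<chi> i. exp (of_real \<beta> * w $ i))"
  have arg: "\<bar>\<beta> * Im (w $ i)\<bar> < \<alpha> * pi / 2" for i
    using w[of i] assms(1) by (simp add: abs_mult field_simps)
  have "z $ i \<in> sector \<alpha>" for i
    unfolding sector_def z_def using arg[of i]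
    by (intro CollectI exI[of _ "exp (\<beta> * Re (w $ i))"] exI[of _ "\<beta> * Im (w $ i)"]) (simp add: exp_eq_polar)
  then have "posy_principal A c z \<noteq> 0" using stable by (simp add: sector_stable_def)
  also have "posy_principal A c z = (\<Sum>a\<in>A. of_real (c a) * exp (\<Sum>i\<in>UNIV. of_real ((\<beta> *\<^sub>R a) $ i) * w $ i))"
  proof -
    have "Ln (z $ i) = of_real \<beta> * w $ i" for i
    proof -
      have "\<alpha> * pi / 2 \<le> pi / 2" using assms(3) by simp
      then have "- pi < \<beta> * Im (w $ i)" "\<beta> * Im (w $ i) \<le> pi"
        using arg[of i] pi_gt_zero by linarith+
      then show ?thesis by (simp add: z_def)
    qed
    moreover have "z $ i \<noteq> 0" for i by (simp add: z_def)
    ultimately show ?thesis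
      by (simp add: posy_principal_def powr_def exp_sum mult_ac)
  qed
  finally show ?thesis .
qed

text \<open>The strict inequality \<open>\<beta> < \<alpha>\<close> leaves room around the closed tube on which the logarithm is
  estimated; the case \<open>\<beta> = \<alpha>\<close> follows by letting \<open>\<beta>\<close> tend to \<open>\<alpha>\<close>.\<close>

lemma powr_posy_eval_superadditive:
  fixes A :: "(real ^ 'n) set"
  assumes "0 < \<beta>" "\<beta> < \<alpha>" "\<alpha> \<le> 1" and p: "posynomial A c" and hom: "homogeneous_of_degree d A" "0 < d"
    and stable: "sector_stable \<alpha> A c" and x: "x \<in> pos_orthant" and y: "y \<in> pos_orthant"
  defines "F \<equiv> \<lambda>x. posy_eval A c (\<chi> i. (x $ i) powr \<beta>) powr (1 / (\<beta> * d))"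
  shows "F x + F y \<le> F (x + y)"
proof -
  interpret stable_expsum A c "\<lambda>a. \<beta> *\<^sub>R a" "\<beta> * d" "\<alpha> * pi / (2 * \<beta>)"
  proof
    show "pi / 2 < \<alpha> * pi / (2 * \<beta>)" using assms(1,2) by (simp add: field_simps)
    show "(\<Sum>a\<in>A. of_real (c a) * exp (\<Sum>i\<in>UNIV. of_real ((\<beta> *\<^sub>R a) $ i) * w $ i)) \<noteq> 0"
      if "\<And>i. \<bar>Im (w $ i)\<bar> < \<alpha> * pi / (2 * \<beta>)" for w
      by (rule sector_stable_expsum_nonzero[OF assms(1-3) stable that])
  qed (use p hom assms(1) in \<open>auto simp: posynomial_def homogeneous_of_degree_def simp flip: sum_distrib_left\<close>)
  obtain g where "continuous_on tube g" "\<And>w. w \<in> tube \<Longrightarrow> exp (g w) = Q w"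
    "\<And>x. g (\<chi> i. of_real (x $ i)) = of_real (ln (Qr x))"
    using log_branch by blast
  then interpret stable_expsum_log A c "\<lambda>a. \<beta> *\<^sub>R a" "\<beta> * d" "\<alpha> * pi / (2 * \<beta>)" g
    by unfold_locales
  have "F v = h v" if "v \<in> pos_orthant" for v
  proof -
    have "Qr (\<chi> i. ln (v $ i)) = posy_eval A c (\<chi> i. (v $ i) powr \<beta>)"
      using that by (simp add: posy_eval_powr Qr_def)
    moreover have "Qr (\<chi> i. ln (v $ i)) \<noteq> 0" using Qr_pos less_imp_neq[symmetric] by blast
    ultimately show ?thesis by (simp add: F_def h_def powr_def)
  qed
  moreover have "x + y \<in> pos_orthant" using x y by (simp add: pos_orthant_def add_pos_pos)
  ultimately show ?thesis
    using h_superadditive[of x y] x y by (simp add: pos_orthant_def)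
qed

theorem corollary2:
  fixes A :: "(real ^ 'n) set" and c :: "real ^ 'n \<Rightarrow> real" and \<alpha> d :: real
  assumes "0 < \<alpha>" and "\<alpha> \<le> 1"
    and "posynomial A c"
    and "homogeneous_of_degree d A" and "0 < d"
    and "sector_stable \<alpha> A c"
  shows "concave_on pos_orthant (\<lambda>x. posy_eval A c (\<chi> i. (x $ i) powr \<alpha>) powr (1 / (\<alpha> * d)))
       \<and> concave_on pos_orthant (\<lambda>x. ln (posy_eval A c (\<chi> i. (x $ i) powr \<alpha>)))"
proof -
  define P where "P \<gamma> x = posy_eval A c (\<chi> i. (x $ i) powr \<gamma>)" for \<gamma> x
  define F where "F \<gamma> x = P \<gamma> x powr (1 / (\<gamma> * d))" for \<gamma> x
  have Ppos: "0 < P \<gamma> x" if "x \<in> pos_orthant" for \<gamma> x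
    unfolding P_def by (rule posy_eval_pos[OF assms(3) sector_stable_nonempty[OF assms(1,6)] that])
  have lim: "((\<lambda>\<beta>. F \<beta> x) \<longlongrightarrow> F \<alpha> x) (at_left \<alpha>)" if x: "x \<in> pos_orthant" for x
  proof -
    have "((\<lambda>\<beta>. P \<beta> x) \<longlongrightarrow> P \<alpha> x) (at_left \<alpha>)"
      unfolding P_def posy_eval_powr[OF x] by (intro tendsto_intros)
    then show ?thesis
      unfolding F_def using Ppos[OF x] assms(1,5) by (intro tendsto_intros) (auto simp: less_imp_neq[symmetric])
  qed
  have add_mem: "x + y \<in> pos_orthant" if "x \<in> pos_orthant" "y \<in> pos_orthant" for x y :: "real ^ 'n"
    using that by (simp add: pos_orthant_def add_pos_pos)
  have scale_mem: "t *\<^sub>R x \<in> pos_orthant" if "x \<in> pos_orthant" "0 < t" for x :: "real ^ 'n" and t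
    using that by (simp add: pos_orthant_def)
  have superadd: "F \<alpha> x + F \<alpha> y \<le> F \<alpha> (x + y)" if "x \<in> pos_orthant" "y \<in> pos_orthant" for x y
  proof (rule tendsto_le)
    show "((\<lambda>\<beta>. F \<beta> (x + y)) \<longlongrightarrow> F \<alpha> (x + y)) (at_left \<alpha>)"
      by (rule lim[OF add_mem[OF that]])
    show "((\<lambda>\<beta>. F \<beta> x + F \<beta> y) \<longlongrightarrow> F \<alpha> x + F \<alpha> y) (at_left \<alpha>)"
      by (intro tendsto_add lim that)
    have "\<forall>\<^sub>F \<beta> in at_left \<alpha>. \<beta> \<in> {0<..<\<alpha>}"
      using assms(1) by (rule eventually_at_left_real)
    then show "\<forall>\<^sub>F \<beta> in at_left \<alpha>. F \<beta> x + F \<beta> y \<le> F \<beta> (x + y)"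
    proof eventually_elim
      case (elim \<beta>)
      then show ?case
        using powr_posy_eval_superadditive[of \<beta> \<alpha> A c d x y] assms that by (simp add: F_def P_def)
    qed
  qed simp
  have F_scale: "F \<alpha> (t *\<^sub>R x) = t * F \<alpha> x" if "x \<in> pos_orthant" "0 < t" for x t
    using posy_eval_scale[OF assms(4) that, of c \<alpha>] Ppos[OF that(1), of \<alpha>] that assms(1,5)
    by (simp add: F_def P_def powr_mult powr_powr)
  \<comment> \<open>Superadditivity at \<open>(1 - t) x\<close> and \<open>t y\<close>, combined
    with homogeneity of degree one.\<close>
  have F_concave: "(1 - t) * F \<alpha> x + t * F \<alpha> y \<le> F \<alpha> ((1 - t) *\<^sub>R x + t *\<^sub>R y)"
    if "0 < t" "t < 1" "x \<in> pos_orthant" "y \<in> pos_orthant" for t x y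
    using superadd[of "(1 - t) *\<^sub>R x" "t *\<^sub>R y"] that by (simp add: F_scale scale_mem)
  have convex: "convex (pos_orthant :: (real ^ 'n) set)"
    unfolding convex_alt
    by (metis (no_types) add.right_neutral add_mem diff_zero diff_self le_less scale_mem scaleR_one
        scaleR_zero_left add_0 diff_gt_0_iff_gt)
  have "concave_on pos_orthant (F \<alpha>)"
    by (rule concave_onI[OF _ convex]) (rule F_concave)
  \<comment> \<open>\<open>ln (P \<alpha> x)\<close> is the positive multiple
    \<open>\<alpha> * d\<close> of \<open>ln (F \<alpha> x)\<close>, and \<open>ln\<close> is
    increasing and concave.\<close>
  moreover have "concave_on pos_orthant (\<lambda>x. ln (P \<alpha> x))"
  proof (rule concave_onI[OF _ convex])
    fix t :: real and x y :: "real ^ 'n"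
    assume t: "0 < t" "t < 1" and x: "x \<in> pos_orthant" and y: "y \<in> pos_orthant"
    let ?m = "(1 - t) *\<^sub>R x + t *\<^sub>R y"
    have m: "?m \<in> pos_orthant" using t x y by (intro add_mem scale_mem) auto
    have Fpos: "0 < F \<alpha> v" if "v \<in> pos_orthant" for v
      using Ppos[OF that, of \<alpha>] by (simp add: F_def)
    have lnP: "ln (P \<alpha> v) = \<alpha> * d * ln (F \<alpha> v)" if "v \<in> pos_orthant" for v
      using Ppos[OF that, of \<alpha>] assms(1,5) by (simp add: F_def ln_powr)
    have "(1 - t) * ln (F \<alpha> x) + t * ln (F \<alpha> y) \<le> ln ((1 - t) * F \<alpha> x + t * F \<alpha> y)"
      using concave_onD[OF ln_concave, of t "F \<alpha> x" "F \<alpha> y"] t Fpos x y by simp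
    also have "\<dots> \<le> ln (F \<alpha> ?m)"
      using F_concave[OF t x y] Fpos x y t by (intro ln_mono) (auto intro!: add_pos_pos)
    finally have "\<alpha> * d * ((1 - t) * ln (F \<alpha> x) + t * ln (F \<alpha> y)) \<le> \<alpha> * d * ln (F \<alpha> ?m)"
      using assms(1,5) by (intro mult_left_mono) auto
    then show "(1 - t) * ln (P \<alpha> x) + t * ln (P \<alpha> y) \<le> ln (P \<alpha> ?m)"
      unfolding lnP[OF x] lnP[OF y] lnP[OF m] by (simp add: algebra_simps)
  qed
  ultimately show ?thesis by (simp add: F_def[abs_def] P_def)
qed

end
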